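(* Let $p,q$ be positive integers and suppose that $(X,Y)\sim\mathcal N_{p+q}(\mu,\Sigma)$, where $X\in\mathbb{R}^p$, $Y\in\mathbb{R}^q$ and $$\Sigma=\begin{pmatrix}\Sigma_X&\Sigma_{XY}\\ \Sigma_{YX}&\Sigma_Y\end{pmatrix}$$ with $\Sigma_X\in\mathbb{R}^{p\times p}$ and $\Sigma_Y\in\mathbb{R}^{q\times q}$ nonsingular and $\Sigma_{XY}\in\mathbb{R}^{p\times q}$. Then $$\widetilde{\mathcal V}^2(X,X)=4\pi\,\frac{c_{p-1}^2}{c_p^2}\,A(p),$$ where $$A(p)=\frac{\Gamma(\frac12p)\,\Gamma(\frac12p+1)}{\bigl[\Gamma\bigl(\frac12(p+1)\bigr)\bigr]^2}-2\,{}_2F_1\bigl(-\tfrac12,-\tfrac12;\tfrac12p;\tfrac14\bigr)+1 .$$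
   Context: $|\cdot|_p$ and $\langle\cdot,\cdot\rangle_p$ denote the Euclidean norm and scalar product on $\mathbb{R}^p$; $c_p=\pi^{(p+1)/2}/\Gamma((p+1)/2)$ (for integers $p\ge0$); ${}_2F_1$ is the Gaussian hypergeometric function. For jointly distributed random vectors $U\in\mathbb{R}^p$, $V\in\mathbb{R}^q$ let $f_{U,V}(s,t)=\mathbb{E}\exp[\mathrm{i}\langle s,U\rangle_p+\mathrm{i}\langle t,V\rangle_q]$, $f_U(s)=f_{U,V}(s,0)$, $f_V(t)=f_{U,V}(0,t)$. The distance covariance $\mathcal V(U,V)\ge0$ is defined by $$\mathcal V^2(U,V)=\frac{1}{c_pc_q}\int_{\mathbb{R}^{p+q}}\frac{|f_{U,V}(s,t)-f_U(s)f_V(t)|^2}{|s|_p^{p+1}|t|_q^{q+1}}\,ds\,dt .$$ For $U,V$ with finite second moments and nonsingular covariance matrices $\Sigma_U,\Sigma_V$, the affinely invariant distance covariance $\widetilde{\mathcal V}(U,V)\ge0$ is defined by $\widetilde{\mathcal V}^2(U,V)=\mathcal V^2(\Sigma_U^{-1/2}U,\Sigma_V^{-1/2}V)$. In particular $\widetilde{\mathcal V}^2(X,X)=\mathcal V^2(\Sigma_X^{-1/2}X,\Sigma_X^{-1/2}X)$, where both arguments are the same random vector. $\mathcal N_{p+q}(\mu,\Sigma)$ is the multivariate normal distribution with mean $\mu\in\mathbb{R}^{p+q}$ and covariance matrix $\Sigma$ (possibly singular); $\Sigma_{YX}=\Sigma_{XY}'$. *)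

theory Defs
  imports "HOL-Probability.Probability"
begin

definition c_const :: "nat \<Rightarrow> real" where
  "c_const p = pi powr ((real p + 1) / 2) / Gamma ((real p + 1) / 2)"

(* The Gauss series; it represents the hypergeometric function for \<bar>z\<bar> < 1 and
   c not a nonpositive integer. *)
definition hyp2F1 :: "real \<Rightarrow> real \<Rightarrow> real \<Rightarrow> real \<Rightarrow> real" where
  "hyp2F1 a b c z = eval_fps (fps_hypergeo [a, b] [c] 1) z"

definition A_const :: "nat \<Rightarrow> real" where
  "A_const p = Gamma (real p / 2) * Gamma (real p / 2 + 1) / (Gamma ((real p + 1) / 2))\<^sup>2
     - 2 * hyp2F1 (-1/2) (-1/2) (real p / 2) (1/4) + 1"

definition psd_matrix :: "real ^ 'n ^ 'n \<Rightarrow> bool" where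
  "psd_matrix A \<longleftrightarrow> transpose A = A \<and> (\<forall>u. 0 \<le> u \<bullet> (A *v u))"

definition matrix_sqrt :: "real ^ 'n ^ 'n \<Rightarrow> real ^ 'n ^ 'n" where
  "matrix_sqrt A = (THE B. psd_matrix B \<and> B ** B = A)"

definition matrix_inv_sqrt :: "real ^ 'n ^ 'n \<Rightarrow> real ^ 'n ^ 'n" where
  "matrix_inv_sqrt A = matrix_inv (matrix_sqrt A)"

definition joint_char ::
  "'a measure \<Rightarrow> ('a \<Rightarrow> 'u) \<Rightarrow> ('a \<Rightarrow> 'v) \<Rightarrow> 'u::euclidean_space \<Rightarrow> 'v::euclidean_space \<Rightarrow> complex"
where
  "joint_char M U V s t = (\<integral>\<omega>. iexp (s \<bullet> U \<omega> + t \<bullet> V \<omega>) \<partial>M)"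

(* On the null set where s = 0 or t = 0 the integrand is 0, since division by zero yields 0.
   The value is meaningful when the integrand is integrable, e.g. for square integrable U and V. *)
definition dist_cov ::
  "'a measure \<Rightarrow> ('a \<Rightarrow> 'u::euclidean_space) \<Rightarrow> ('a \<Rightarrow> 'v::euclidean_space) \<Rightarrow> real"
where
  "dist_cov M U V = sqrt (1 / (c_const DIM('u) * c_const DIM('v)) *
     (\<integral>(s, t). (cmod (joint_char M U V s t - joint_char M U V s 0 * joint_char M U V 0 t))\<^sup>2 /
        (norm s ^ (DIM('u) + 1) * norm t ^ (DIM('v) + 1)) \<partial>lborel))"

definition cov_matrix :: "'a measure \<Rightarrow> ('a \<Rightarrow> real ^ 'n) \<Rightarrow> real ^ 'n ^ 'n" where
  "cov_matrix M U = (\<chi> i j. \<integral>\<omega>. (U \<omega> $ i - (\<integral>\<omega>'. U \<omega>' $ i \<partial>M)) *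
     (U \<omega> $ j - (\<integral>\<omega>'. U \<omega>' $ j \<partial>M)) \<partial>M)"

definition aff_dist_cov ::
  "'a measure \<Rightarrow> ('a \<Rightarrow> real ^ 'p) \<Rightarrow> ('a \<Rightarrow> real ^ 'q) \<Rightarrow> real" where
  "aff_dist_cov M U V = dist_cov M
     (\<lambda>\<omega>. matrix_inv_sqrt (cov_matrix M U) *v U \<omega>)
     (\<lambda>\<omega>. matrix_inv_sqrt (cov_matrix M V) *v V \<omega>)"

(* The normal law on the line, parametrised by its variance v \<ge> 0; for v = 0 it is the
   point mass at m. *)
definition normal_law :: "real \<Rightarrow> real \<Rightarrow> real measure" where
  "normal_law m v = (if v = 0 then return borel m else density lborel (normal_density m (sqrt v)))"

(* A possibly singular multivariate normal law is characterised by its one-dimensional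
   projections.  These only see the symmetric part of the covariance matrix, so symmetry
   has to be demanded separately (it is part of psd_matrix). *)
definition multivariate_normal ::
  "'a measure \<Rightarrow> ('a \<Rightarrow> real ^ 'n) \<Rightarrow> real ^ 'n \<Rightarrow> real ^ 'n ^ 'n \<Rightarrow> bool" where
  "multivariate_normal M W \<mu> \<Sigma> \<longleftrightarrow> W \<in> borel_measurable M \<and> psd_matrix \<Sigma> \<and>
     (\<forall>u. distr M borel (\<lambda>\<omega>. u \<bullet> W \<omega>) = normal_law (u \<bullet> \<mu>) (u \<bullet> (\<Sigma> *v u)))"

(* Vectors in R^(p+q) are indexed by the disjoint sum of the index types. *)
definition stack :: "real ^ 'p \<Rightarrow> real ^ 'q \<Rightarrow> real ^ ('p + 'q)" where
  "stack x y = (\<chi> i. case i of Inl a \<Rightarrow> x $ a | Inr b \<Rightarrow> y $ b)"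

definition block_matrix ::
  "real ^ 'p ^ 'p \<Rightarrow> real ^ 'q ^ 'p \<Rightarrow> real ^ 'p ^ 'q \<Rightarrow> real ^ 'q ^ 'q \<Rightarrow> real ^ ('p + 'q) ^ ('p + 'q)"
where
  "block_matrix A B C D = (\<chi> i j. case i of
       Inl a \<Rightarrow> (case j of Inl a' \<Rightarrow> A $ a $ a' | Inr b' \<Rightarrow> B $ a $ b')
     | Inr b \<Rightarrow> (case j of Inl a' \<Rightarrow> C $ b $ a' | Inr b' \<Rightarrow> D $ b $ b'))"

end

theory Submission
  imports Defs "HOL-Real_Asymp.Real_Asymp"
begin

text \<open>
  Whitening reduces the statement to a Gaussian integral. If \<open>X\<close> is normal with invertible covariance
  matrix, then \<open>W = \<Sigma>\<^sub>X\<^sup>-\<^sup>1\<^sup>/\<^sup>2 X\<close> is normal with identity covariance, its characteristic function at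
  \<open>u\<close> has modulus \<open>exp (- |u|\<^sup>2 / 2)\<close>, and with \<open>p = CARD('p)\<close> the distance covariance integrand becomes
  \[ w(s)\, w(t)\, (e^{- s \cdot t} - 1)^2, \qquad w(s) = e^{-|s|^2} / |s|^{p+1}. \]
  The weight is even, so the last factor may be replaced by its even part
  \[ \cosh(2 s \cdot t) - 2 \cosh(s \cdot t) + 1
     = \sum_{k \ge 1} \frac{4^k - 2}{(2k)!} (s \cdot t)^{2k}, \]
  a series with nonnegative terms, which may be integrated termwise without any convergence
  argument. Each term splits into radial and angular parts, and the resulting series is
  \<open>4 \<pi> c\<^sub>p\<^sub>-\<^sub>1\<^sup>2 \<Sum> (1 - 2 / 4\<^sup>k) a\<^sub>k\<close>, where the \<open>a\<^sub>k\<close> are the coefficients of the Gauss series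
  with parameters \<open>-1/2, -1/2; p/2\<close>. Summing the two parts separately gives the values of that
  series at \<open>1\<close> and at \<open>1/4\<close>, and the former is a quotient of Gamma values by Gauss's theorem.

  Four facts carry the argument. A positive semidefinite matrix has a positive semidefinite square
  root (spectral theorem), and it is unique in the invertible case, so \<open>matrix_inv_sqrt\<close> denotes
  what it should. A homogeneous function has a radial law with power density
  (\<open>homogeneous_radial_integral\<close>), so inserting powers of the norm into a Gaussian integral only
  changes a Gamma factor. The even moments of \<open>s \<bullet> t\<close> under the Gaussian weight follow from its
  moment generating function by comparing power series (\<open>nn_integral_gaussian_moment\<close>). Gauss's
  theorem for the parameters \<open>-1/2, -1/2; c\<close> follows from a telescoping contiguous relation that
  raises \<open>c\<close> to \<open>c + 1\<close> (\<open>gauss_sum_minus_half\<close>).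
\<close>

section \<open>Square roots of positive semidefinite matrices\<close>

text \<open>
  First-order condition at a maximum: near \<open>t = 0\<close> the linear term dominates the quadratic one, so
  a nonzero \<open>b\<close> would give a positive value at the scale \<open>t = b / |c|\<close>.
\<close>

lemma linear_coefficient_zero_of_quadratic_nonpos:
  fixes b c :: real
  assumes "\<And>t. 2 * t * b + t\<^sup>2 * c \<le> 0"
  shows "b = 0"
proof (rule ccontr)
  assume "b \<noteq> 0"
  show False
  proof (cases "c = 0")
    case True
    with assms[of b] \<open>b \<noteq> 0\<close> show False
      by (simp add: power2_eq_square[symmetric] mult.assoc)
  next
    case False
    define t where "t = b / (\<bar>c\<bar>)"
    have "t\<^sup>2 * c \<ge> - (t\<^sup>2 * \<bar>c\<bar>)"
      by (metis abs_ge_minus_self minus_le_iff mult_left_mono mult_minus_right zero_le_power2)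
    moreover have "t\<^sup>2 * \<bar>c\<bar> = b\<^sup>2 / \<bar>c\<bar>"
      using False by (simp add: t_def power2_eq_square abs_if)
    moreover have "2 * t * b = 2 * (b\<^sup>2 / \<bar>c\<bar>)"
      by (simp add: t_def power2_eq_square)
    moreover have "b\<^sup>2 / \<bar>c\<bar> > 0"
      using False \<open>b \<noteq> 0\<close> by simp
    ultimately show False using assms[of t] by linarith
  qed
qed

text \<open>
  A vector at which a nonpositive quadratic form vanishes is a maximum of the form, hence a critical
  point. Perturbing \<open>v\<close> in the direction \<open>g v\<close> itself turns criticality into \<open>|g v|\<^sup>2 = 0\<close>.
\<close>

lemma selfadjoint_nonpos_kernel:
  fixes g :: "'a::real_inner \<Rightarrow> 'a"
  assumes "linear g" and sa: "\<And>x y. g x \<bullet> y = x \<bullet> g y"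
    and S: "subspace S" "g ` S \<subseteq> S"
    and np: "\<And>x. x \<in> S \<Longrightarrow> x \<bullet> g x \<le> 0" and v: "v \<in> S" "v \<bullet> g v = 0"
  shows "g v = 0"
proof -
  interpret linear g by fact
  have "2 * t * (g v \<bullet> g v) + t\<^sup>2 * (g v \<bullet> g (g v)) \<le> 0" for t
  proof -
    have "v + t *\<^sub>R g v \<in> S"
      using S v by (auto intro!: subspace_add subspace_mul)
    from np[OF this] show ?thesis
      using v sa[of v "g v"]
      by (simp add: add scaleR inner_add_left inner_add_right power2_eq_square algebra_simps)
  qed
  from linear_coefficient_zero_of_quadratic_nonpos[OF this] show ?thesis by simp
qed

text \<open>
  A maximiser \<open>v\<close> of the quadratic form on the unit sphere of \<open>S\<close> is an eigenvector: with
  \<open>l\<close> the maximal value, \<open>f - l\<close> is nonpositive on \<open>S\<close> and vanishes at \<open>v\<close>.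
\<close>

lemma selfadjoint_eigenvector:
  fixes f :: "'a::euclidean_space \<Rightarrow> 'a"
  assumes f: "linear f" and sa: "\<And>x y. f x \<bullet> y = x \<bullet> f y"
    and S: "subspace S" "f ` S \<subseteq> S" "S \<noteq> {0}"
  obtains v where "v \<in> S" "norm v = 1" "f v = (v \<bullet> f v) *\<^sub>R v"
proof -
  interpret linear f by fact
  obtain w where w: "w \<in> S" "w \<noteq> 0"
    using S subspace_0 by blast
  have "compact (sphere 0 1 \<inter> S)"
    using S by (intro compact_Int_closed closed_subspace) auto
  moreover have "w /\<^sub>R norm w \<in> sphere 0 1 \<inter> S"
    using w S by (auto intro: subspace_mul)
  moreover have "continuous_on (sphere 0 1 \<inter> S) (\<lambda>x. x \<bullet> f x)"
    using f by (intro continuous_intros linear_continuous_on) (simp add: linear_conv_bounded_linear)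
  ultimately obtain v where v: "v \<in> sphere 0 1 \<inter> S"
    and mx: "\<And>x. x \<in> sphere 0 1 \<inter> S \<Longrightarrow> x \<bullet> f x \<le> v \<bullet> f v"
    using continuous_attains_sup[of "sphere 0 1 \<inter> S" "\<lambda>x. x \<bullet> f x"] by blast
  define l where "l = v \<bullet> f v"
  define g where "g x = f x - l *\<^sub>R x" for x
  have lg: "linear g"
    unfolding g_def by (intro linear_compose_sub linear_axioms) (simp add: linear_iff algebra_simps)
  have vv: "v \<bullet> v = 1"
    using v by (simp add: norm_eq_1)
  have "g v = 0"
  proof (rule selfadjoint_nonpos_kernel[OF lg _ S(1)])
    show "g x \<bullet> y = x \<bullet> g y" for x y
      by (simp add: g_def inner_diff_left inner_diff_right sa)
    show "g ` S \<subseteq> S"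
      using S by (auto simp: g_def intro!: subspace_diff subspace_mul)
    show "v \<in> S" "v \<bullet> g v = 0"
      using v vv by (auto simp: g_def l_def inner_diff_right)
    fix x assume x: "x \<in> S"
    show "x \<bullet> g x \<le> 0"
    proof (cases "x = 0")
      case False
      have "(x /\<^sub>R norm x) \<bullet> f (x /\<^sub>R norm x) \<le> l"
        unfolding l_def using False x S by (intro mx) (auto intro: subspace_mul)
      then have "x \<bullet> f x \<le> l * (norm x * norm x)"
        using False by (simp add: scaleR field_simps)
      then show ?thesis
        by (simp add: g_def inner_diff_right dot_square_norm power2_eq_square)
    qed simp
  qed
  then show thesis
    using v by (intro that[of v]) (auto simp: g_def l_def)
qed

text \<open>
  Spectral theorem. Instead of an induction on the dimension, take an orthonormal set of eigenvectors
  of maximal cardinality: its orthogonal complement is invariant, so a nonzero complement would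
  contain one more eigenvector.
\<close>

lemma selfadjoint_orthonormal_eigenbasis:
  fixes f :: "'a::euclidean_space \<Rightarrow> 'a"
  assumes f: "linear f" and sa: "\<And>x y. f x \<bullet> y = x \<bullet> f y"
  obtains E where "finite E" "pairwise orthogonal E" "\<And>e. e \<in> E \<Longrightarrow> norm e = 1"
    "\<And>e. e \<in> E \<Longrightarrow> f e = (e \<bullet> f e) *\<^sub>R e" "\<And>x. (\<Sum>e\<in>E. (e \<bullet> x) *\<^sub>R e) = x"
proof -
  interpret linear f by fact
  define P where "P E \<longleftrightarrow> pairwise orthogonal E \<and> (\<forall>e\<in>E. norm e = 1 \<and> f e = (e \<bullet> f e) *\<^sub>R e)"
    for E
  have bd: "finite E \<and> card E \<le> DIM('a)" if "P E" for E
  proof -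
    have "independent E"
      using that by (intro pairwise_orthogonal_independent) (auto simp: P_def)
    then show ?thesis by (simp add: independent_bound)
  qed
  have "\<exists>E. P E \<and> (\<forall>E'. P E' \<longrightarrow> card E' \<le> card E)"
  proof (rule ex_has_greatest_nat)
    show "P {}" by (simp add: P_def)
    show "\<forall>E. P E \<longrightarrow> card E < DIM('a) + 1" using bd by (simp add: less_Suc_eq_le)
  qed
  then obtain E where E: "P E" and mx: "\<And>E'. P E' \<Longrightarrow> card E' \<le> card E" by blast
  have fin: "finite E" using bd E by blast
  have EE: "pairwise orthogonal E" "\<And>e. e \<in> E \<Longrightarrow> norm e = 1"
    "\<And>e. e \<in> E \<Longrightarrow> f e = (e \<bullet> f e) *\<^sub>R e"
    using E by (auto simp: P_def)
  define S where "S = {x. \<forall>e\<in>E. e \<bullet> x = 0}"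
  have S0: "S = {0}"
  proof (rule ccontr)
    assume "S \<noteq> {0}"
    moreover have "subspace S"
      by (auto simp: S_def subspace_def inner_add_right)
    moreover have "f ` S \<subseteq> S"
    proof safe
      fix x assume "x \<in> S"
      have "e \<bullet> f x = 0" if "e \<in> E" for e
      proof -
        have "e \<bullet> f x = f e \<bullet> x" by (simp add: sa)
        also have "\<dots> = (e \<bullet> f e) * (e \<bullet> x)" by (subst EE(3)[OF that]) simp
        also have "\<dots> = 0" using \<open>x \<in> S\<close> that by (simp add: S_def)
        finally show ?thesis .
      qed
      then show "f x \<in> S" by (simp add: S_def)
    qed
    ultimately obtain v where v: "v \<in> S" "norm v = 1" "f v = (v \<bullet> f v) *\<^sub>R v"
      using selfadjoint_eigenvector[OF f sa] by blast
    have "v \<notin> E"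
      using v by (auto simp: S_def norm_eq_1)
    moreover have "P (insert v E)"
      using E v by (auto simp: P_def S_def pairwise_insert orthogonal_def inner_commute)
    ultimately show False
      using mx[of "insert v E"] fin by simp
  qed
  have "(\<Sum>e\<in>E. (e \<bullet> x) *\<^sub>R e) = x" for x
  proof -
    have "e \<bullet> (\<Sum>e'\<in>E. (e' \<bullet> x) *\<^sub>R e') = e \<bullet> x" if "e \<in> E" for e
    proof -
      have "e \<bullet> (\<Sum>e'\<in>E. (e' \<bullet> x) *\<^sub>R e') = (\<Sum>e'\<in>E. if e' = e then e \<bullet> x else 0)"
        unfolding inner_sum_right using EE that
        by (intro sum.cong) (auto simp: pairwise_def orthogonal_def norm_eq_1)
      then show ?thesis using fin that by simp
    qed
    then have "(\<Sum>e\<in>E. (e \<bullet> x) *\<^sub>R e) - x \<in> S"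
      by (simp add: S_def inner_diff_right)
    then show ?thesis using S0 by simp
  qed
  with fin EE show thesis by (rule that)
qed

lemma symmetric_matrix_inner:
  fixes A :: "real ^ 'n ^ 'n"
  assumes "transpose A = A"
  shows "(A *v x) \<bullet> y = x \<bullet> (A *v y)"
  using assms by (metis dot_lmul_matrix vector_transpose_matrix)

text \<open>
  The root acts on the eigenvector \<open>e\<close> as multiplication by the square root of its eigenvalue
  \<open>e \<bullet> A e\<close>.
\<close>

lemma psd_matrix_sqrt_exists:
  fixes A :: "real ^ 'n ^ 'n"
  assumes "psd_matrix A"
  obtains B where "psd_matrix B" "B ** B = A"
proof -
  have A: "transpose A = A" "\<And>u. 0 \<le> u \<bullet> (A *v u)"
    using assms by (auto simp: psd_matrix_def)
  obtain E where E: "finite E" "pairwise orthogonal E" "\<And>e. e \<in> E \<Longrightarrow> norm e = 1"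
    "\<And>e. e \<in> E \<Longrightarrow> A *v e = (e \<bullet> (A *v e)) *\<^sub>R e" "\<And>x. (\<Sum>e\<in>E. (e \<bullet> x) *\<^sub>R e) = x"
    using selfadjoint_orthonormal_eigenbasis[of "(*v) A"] symmetric_matrix_inner[OF A(1)]
      matrix_vector_mul_linear[of A] by blast
  define r where "r e = sqrt (e \<bullet> (A *v e))" for e
  define g where "g x = (\<Sum>e\<in>E. (r e * (e \<bullet> x)) *\<^sub>R e)" for x :: "real ^ 'n"
  have lg: "linear g"
    by (auto simp: g_def linear_iff inner_add_right algebra_simps sum.distrib scaleR_sum_right)
  define B where "B = matrix g"
  have Bg: "B *v x = g x" for x
    unfolding B_def using lg by (simp add: matrix_works linear_matrix_vector_mul_eq)
  have "x \<bullet> g y = g x \<bullet> y" for x y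
    by (auto simp: g_def inner_sum_right inner_sum_left inner_commute intro!: sum.cong)
  then have "transpose B = B"
    by (metis Bg matrix_eq dot_lmul_matrix vector_transpose_matrix vector_eq_ldot)
  moreover have "0 \<le> u \<bullet> (B *v u)" for u
    unfolding Bg g_def inner_sum_right
    by (auto intro!: sum_nonneg simp: r_def A inner_commute mult.assoc)
  ultimately have "psd_matrix B" by (simp add: psd_matrix_def)
  moreover have "B ** B = A"
  proof -
    have ge: "g e = r e *\<^sub>R e" if "e \<in> E" for e
    proof -
      have "g e = (\<Sum>e'\<in>E. if e' = e then r e *\<^sub>R e else 0)"
        unfolding g_def using E that
        by (intro sum.cong) (auto simp: pairwise_def orthogonal_def norm_eq_1)
      then show ?thesis using E that by simp
    qed
    interpret g: linear g by fact
    have "g (g x) = A *v x" for x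
    proof -
      have "g (g x) = (\<Sum>e\<in>E. (r e * (e \<bullet> x)) *\<^sub>R g e)"
        by (subst (2) g_def) (simp add: g.sum g.scaleR)
      also have "\<dots> = (\<Sum>e\<in>E. (e \<bullet> x) *\<^sub>R (A *v e))"
      proof (rule sum.cong)
        fix e assume e: "e \<in> E"
        have "r e * r e = e \<bullet> (A *v e)"
          by (simp add: r_def A)
        then have "(r e * (e \<bullet> x)) *\<^sub>R g e = (e \<bullet> x) *\<^sub>R ((e \<bullet> (A *v e)) *\<^sub>R e)"
          by (simp add: ge[OF e] mult_ac)
        then show "(r e * (e \<bullet> x)) *\<^sub>R g e = (e \<bullet> x) *\<^sub>R (A *v e)"
          using E(4)[OF e] by simp
      qed simp
      also have "\<dots> = A *v (\<Sum>e\<in>E. (e \<bullet> x) *\<^sub>R e)"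
        by (simp add: linear_sum[OF matrix_vector_mul_linear] matrix_vector_mult_scaleR)
      finally show ?thesis by (simp add: E)
    qed
    then show ?thesis
      by (simp add: matrix_eq Bg matrix_vector_mul_assoc[symmetric])
  qed
  ultimately show thesis by (rule that)
qed

lemma psd_matrix_kernel:
  fixes A :: "real ^ 'n ^ 'n"
  assumes "psd_matrix A" "v \<bullet> (A *v v) = 0"
  shows "A *v v = 0"
proof -
  have A: "transpose A = A" "\<And>u. 0 \<le> u \<bullet> (A *v u)"
    using assms by (auto simp: psd_matrix_def)
  have "- (A *v v) = 0"
    by (rule selfadjoint_nonpos_kernel[where S = UNIV and g = "\<lambda>x. - (A *v x)"])
      (use assms A symmetric_matrix_inner[OF A(1)] in \<open>auto intro!: linear_compose_neg matrix_vector_mul_linear\<close>)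
  then show ?thesis by simp
qed

text \<open>
  For \<open>D = B - C\<close>, the equation \<open>B\<^sup>2 = C\<^sup>2\<close> reads \<open>B D = - D C\<close>. Multiplying by \<open>D\<close> and taking traces
  gives \<open>tr (D B D) + tr (D C D) = 0\<close>, where both summands are nonnegative. So the quadratic form
  of \<open>B\<close> vanishes at every column of \<open>D\<close>; then \<open>B\<close> annihilates the column, and it is zero because
  \<open>B\<close> is invertible.
\<close>

lemma psd_matrix_sqrt_unique:
  fixes B C :: "real ^ 'n ^ 'n"
  assumes B: "psd_matrix B" and C: "psd_matrix C" and eq: "B ** B = C ** C" and inv: "invertible B"
  shows "B = C"
proof -
  define D where "D = B - C"
  have sym: "transpose B = B" "transpose C = C" using B C by (auto simp: psd_matrix_def)
  have tD: "transpose D = D"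
    using sym by (simp add: D_def transpose_def vec_eq_iff)
  have neg: "(- K) *v x = - (K *v x)" for K :: "real ^ 'n ^ 'n" and x
    by (metis diff_0 matrix_vector_mult_0 matrix_vector_mult_diff_rdistrib)
  have BD: "B ** D = - (D ** C)"
    using eq by (simp add: D_def matrix_eq matrix_vector_mul_assoc[symmetric] neg
        matrix_vector_mult_diff_rdistrib matrix_vector_mult_diff_distrib)
  have "trace (D ** (B ** D)) = - trace (D ** (D ** C))"
    unfolding BD by (simp add: trace_def matrix_matrix_mult_def sum_negf)
  also have "trace (D ** (D ** C)) = trace (D ** (C ** D))"
    by (metis matrix_mul_assoc trace_mul_sym)
  finally have tr: "trace (D ** (B ** D)) + trace (D ** (C ** D)) = 0" by simp
  \<comment> \<open>The trace of \<open>D K D\<close> is the sum of the quadratic form of \<open>K\<close> over the columns of \<open>D\<close>.\<close>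
  have trD: "trace (D ** (K ** D)) = (\<Sum>i\<in>UNIV. (D *v axis i 1) \<bullet> (K *v (D *v axis i 1)))" for K
  proof -
    have "trace (D ** (K ** D)) = (\<Sum>i\<in>UNIV. axis i 1 \<bullet> ((D ** (K ** D)) *v axis i 1))"
      by (simp add: trace_def inner_axis' matrix_vector_mult_basis column_def)
    then show ?thesis
      by (simp add: matrix_vector_mul_assoc[symmetric] symmetric_matrix_inner[OF tD])
  qed
  have nn: "0 \<le> (D *v axis i 1) \<bullet> (B *v (D *v axis i 1))" "0 \<le> (D *v axis i 1) \<bullet> (C *v (D *v axis i 1))" for i
    using B C by (auto simp: psd_matrix_def)
  have "(\<Sum>i\<in>UNIV. (D *v axis i 1) \<bullet> (B *v (D *v axis i 1))) = 0"
    using tr nn unfolding trD by (smt (verit) sum_nonneg)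
  then have z: "(D *v axis i 1) \<bullet> (B *v (D *v axis i 1)) = 0" for i
    using nn by (simp add: sum_nonneg_eq_0_iff)
  have "D *v axis i 1 = 0" for i
    using psd_matrix_kernel[OF B z[of i]] inv
    by (metis invertible_def matrix_vector_mul_assoc matrix_vector_mul_lid matrix_vector_mult_0_right)
  then have "D = 0"
    by (simp add: vec_eq_iff matrix_vector_mult_basis column_def)
  then show ?thesis by (simp add: D_def)
qed

text \<open>
  The two properties of the matrix that are needed for whitening: it is symmetric, and
  conjugating \<open>A\<close> by it gives the identity.
\<close>

lemma matrix_inv_sqrt_whitens:
  fixes A :: "real ^ 'n ^ 'n"
  assumes "psd_matrix A" "invertible A"
  shows "u \<bullet> (matrix_inv_sqrt A *v x) = (matrix_inv_sqrt A *v u) \<bullet> x"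
    and "(matrix_inv_sqrt A *v u) \<bullet> (A *v (matrix_inv_sqrt A *v u)) = u \<bullet> u"
proof -
  obtain B where B: "psd_matrix B" "B ** B = A"
    using psd_matrix_sqrt_exists[OF assms(1)] by blast
  have inv: "invertible B"
    using assms(2) B(2) by (metis invertible_det_nz det_mul mult_zero_left)
  have sqrt: "matrix_sqrt A = B"
    unfolding matrix_sqrt_def using B psd_matrix_sqrt_unique[OF B(1) _ _ inv] by (intro the_equality) metis+
  define R where "R = matrix_inv B"
  have R: "B ** R = mat 1" "R ** B = mat 1"
    using someI_ex[OF inv[unfolded invertible_def]] by (simp_all add: R_def matrix_inv_def)
  have tB: "transpose B = B" using B by (simp add: psd_matrix_def)
  have tR: "transpose R = R"
    by (metis R tB matrix_transpose_mul transpose_mat matrix_mul_assoc matrix_mul_lid matrix_mul_rid)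
  have eq: "matrix_inv_sqrt A = R" by (simp add: matrix_inv_sqrt_def sqrt R_def)
  show "u \<bullet> (matrix_inv_sqrt A *v x) = (matrix_inv_sqrt A *v u) \<bullet> x"
    unfolding eq by (simp add: symmetric_matrix_inner[OF tR])
  have "(R *v u) \<bullet> (A *v (R *v u)) = (B *v (R *v u)) \<bullet> (B *v (R *v u))"
    by (simp add: B(2)[symmetric] matrix_vector_mul_assoc[symmetric] symmetric_matrix_inner[OF tB])
  also have "B *v (R *v u) = u" by (simp add: matrix_vector_mul_assoc R)
  finally show "(matrix_inv_sqrt A *v u) \<bullet> (A *v (matrix_inv_sqrt A *v u)) = u \<bullet> u"
    unfolding eq .
qed

section \<open>Projections of multivariate normal vectors\<close>

lemma normal_law_centred_moments:
  assumes "v \<ge> 0"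
  shows "has_bochner_integral (normal_law m v) (\<lambda>x. x - m) 0"
    and "has_bochner_integral (normal_law m v) (\<lambda>x. (x - m)\<^sup>2) v"
proof -
  have "has_bochner_integral (normal_law m v) (\<lambda>x. x - m) 0 \<and>
      has_bochner_integral (normal_law m v) (\<lambda>x. (x - m)\<^sup>2) v"
  proof (cases "v = 0")
    case True
    then show ?thesis
      by (auto simp: normal_law_def has_bochner_integral_iff integral_return
          intro!: integrableI_bounded) (simp_all add: nn_integral_return)
  next
    case False
    with assms have v: "v > 0" by simp
    have "has_bochner_integral (density lborel (normal_density m (sqrt v))) (\<lambda>x. x - m) 0"
      using normal_moment_odd[of "sqrt v" m 0] v by (intro has_bochner_integral_density) auto
    moreover have "has_bochner_integral (density lborel (normal_density m (sqrt v))) (\<lambda>x. (x - m)\<^sup>2) v"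
      using normal_moment_even[of "sqrt v" m 1] v by (intro has_bochner_integral_density) auto
    ultimately show ?thesis using v by (simp add: normal_law_def)
  qed
  then show "has_bochner_integral (normal_law m v) (\<lambda>x. x - m) 0"
    and "has_bochner_integral (normal_law m v) (\<lambda>x. (x - m)\<^sup>2) v" by auto
qed

text \<open>
  A nondegenerate normal law is an affine image of the standard one; the point mass has to be treated
  separately.
\<close>

lemma normal_law_char:
  assumes "v \<ge> 0"
  shows "(\<integral>x. iexp x \<partial>normal_law m v) = iexp m * exp (- v / 2)"
proof (cases "v = 0")
  case True
  then show ?thesis by (simp add: normal_law_def integral_return)
next
  case False
  with assms have v: "sqrt v > 0" by simp
  interpret N: prob_space std_normal_distribution
    by (rule real_distribution.axioms(1)[OF real_dist_normal_dist])
  have "distributed std_normal_distribution lborel (\<lambda>x. x) std_normal_density"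
    by (auto simp: distributed_def distr_id2)
  from N.normal_density_affine[OF this, of "sqrt v" m]
  have D: "distr std_normal_distribution lborel (\<lambda>x. m + sqrt v * x) = normal_law m v"
    using v False by (simp add: distributed_def normal_law_def)
  have "(\<integral>x. iexp x \<partial>normal_law m v) = (\<integral>x. iexp (m + sqrt v * x) \<partial>std_normal_distribution)"
    unfolding D[symmetric] by (subst integral_distr) auto
  also have "\<dots> = iexp m * char std_normal_distribution (sqrt v)"
    by (simp add: char_def distrib_left exp_add)
  also have "\<dots> = iexp m * exp (- v / 2)"
    using assms by (simp add: char_std_normal_distribution exp_of_real[symmetric] of_real_power[symmetric] del: of_real_power)
  finally show ?thesis .
qed

lemma multivariate_normal_projection_moments:
  assumes "multivariate_normal M W \<mu> S"
  shows "has_bochner_integral M (\<lambda>\<omega>. u \<bullet> (W \<omega> - \<mu>)) 0"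
    and "has_bochner_integral M (\<lambda>\<omega>. (u \<bullet> (W \<omega> - \<mu>))\<^sup>2) (u \<bullet> (S *v u))"
proof -
  have W[measurable]: "W \<in> borel_measurable M"
    and D: "distr M borel (\<lambda>\<omega>. u \<bullet> W \<omega>) = normal_law (u \<bullet> \<mu>) (u \<bullet> (S *v u))"
    and nn: "u \<bullet> (S *v u) \<ge> 0"
    using assms by (auto simp: multivariate_normal_def psd_matrix_def)
  show "has_bochner_integral M (\<lambda>\<omega>. u \<bullet> (W \<omega> - \<mu>)) 0"
    using normal_law_centred_moments(1)[OF nn, of "u \<bullet> \<mu>"] unfolding D[symmetric]
    by (simp add: has_bochner_integral_iff integrable_distr_eq integral_distr inner_diff_right)
  show "has_bochner_integral M (\<lambda>\<omega>. (u \<bullet> (W \<omega> - \<mu>))\<^sup>2) (u \<bullet> (S *v u))"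
    using normal_law_centred_moments(2)[OF nn, of "u \<bullet> \<mu>"] unfolding D[symmetric]
    by (simp add: has_bochner_integral_iff integrable_distr_eq integral_distr inner_diff_right)
qed

text \<open>
  The hypothesis determines variances of projections only. Mixed moments come from polarisation with
  the directions \<open>e\<^sub>i\<close>, \<open>e\<^sub>j\<close> and \<open>e\<^sub>i + e\<^sub>j\<close>; this yields the symmetric part of \<open>S\<close>, that is, \<open>S\<close>.
\<close>

lemma cov_matrix_multivariate_normal:
  assumes "prob_space M" and N: "multivariate_normal M W \<mu> S"
  shows "cov_matrix M W = S"
proof -
  interpret prob_space M by fact
  have mean: "(\<integral>\<omega>. W \<omega> $ i \<partial>M) = \<mu> $ i" for i
  proof -
    have "has_bochner_integral M (\<lambda>\<omega>. axis i 1 \<bullet> (W \<omega> - \<mu>) + \<mu> $ i) (0 + \<mu> $ i)"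
      by (intro has_bochner_integral_add multivariate_normal_projection_moments(1)[OF N])
        (simp add: has_bochner_integral_iff prob_space)
    then show ?thesis by (simp add: inner_axis' has_bochner_integral_iff)
  qed
  have "transpose S = S" using N by (simp add: multivariate_normal_def psd_matrix_def)
  then have sym: "S $ j $ i = S $ i $ j" for i j
    by (metis transpose_def vec_lambda_beta)
  have "(\<integral>\<omega>. (W \<omega> $ i - \<mu> $ i) * (W \<omega> $ j - \<mu> $ j) \<partial>M) = S $ i $ j" for i j
  proof -
    let ?Z = "\<lambda>u \<omega>. (u \<bullet> (W \<omega> - \<mu>))\<^sup>2"
    let ?e = "\<lambda>i. axis i (1::real)"
    note m2 = multivariate_normal_projection_moments(2)[OF N]
    have "has_bochner_integral M (\<lambda>\<omega>. ((?Z (?e i + ?e j) \<omega> - ?Z (?e i) \<omega>) - ?Z (?e j) \<omega>) / 2)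
       ((((?e i + ?e j) \<bullet> (S *v (?e i + ?e j)) - ?e i \<bullet> (S *v ?e i)) - ?e j \<bullet> (S *v ?e j)) / 2)"
      by (intro has_bochner_integral_divide_zero has_bochner_integral_diff m2)
    also have "(\<lambda>\<omega>. ((?Z (?e i + ?e j) \<omega> - ?Z (?e i) \<omega>) - ?Z (?e j) \<omega>) / 2) =
        (\<lambda>\<omega>. (W \<omega> $ i - \<mu> $ i) * (W \<omega> $ j - \<mu> $ j))"
      by (simp add: fun_eq_iff inner_add_left inner_axis' power2_eq_square field_simps)
    also have "(((?e i + ?e j) \<bullet> (S *v (?e i + ?e j)) - ?e i \<bullet> (S *v ?e i)) - ?e j \<bullet> (S *v ?e j)) / 2 = S $ i $ j"
      using sym[of i j]
      by (simp add: inner_add_left inner_axis' matrix_vector_right_distrib matrix_vector_mult_basis column_def)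
    finally show ?thesis by (simp add: has_bochner_integral_iff)
  qed
  then show ?thesis by (simp add: cov_matrix_def mean vec_eq_iff)
qed

lemma multivariate_normal_char:
  assumes "multivariate_normal M W \<mu> S"
  shows "(\<integral>\<omega>. iexp (u \<bullet> W \<omega>) \<partial>M) = iexp (u \<bullet> \<mu>) * exp (- (u \<bullet> (S *v u)) / 2)"
proof -
  have W[measurable]: "W \<in> borel_measurable M"
    and D: "distr M borel (\<lambda>\<omega>. u \<bullet> W \<omega>) = normal_law (u \<bullet> \<mu>) (u \<bullet> (S *v u))"
    and nn: "u \<bullet> (S *v u) \<ge> 0"
    using assms by (auto simp: multivariate_normal_def psd_matrix_def)
  have "(\<integral>\<omega>. iexp (u \<bullet> W \<omega>) \<partial>M) = (\<integral>x. iexp x \<partial>distr M borel (\<lambda>\<omega>. u \<bullet> W \<omega>))"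
    by (subst integral_distr) auto
  then show ?thesis unfolding D using normal_law_char[OF nn] by simp
qed

lemma inner_stack: "stack x y \<bullet> z = x \<bullet> (\<chi> a. z $ Inl a) + y \<bullet> (\<chi> b. z $ Inr b)"
  unfolding inner_vec_def stack_def
  by (simp add: UNIV_Plus_UNIV[symmetric] sum.Plus del: UNIV_Plus_UNIV)

text \<open>
  Projections of \<open>X\<close> are the projections of the stacked vector in directions whose second block is
  zero.
\<close>

lemma multivariate_normal_first_block:
  assumes "multivariate_normal M (\<lambda>\<omega>. stack (X \<omega>) (Y \<omega>)) \<mu> (block_matrix A B C D)"
  shows "multivariate_normal M X (\<chi> a. \<mu> $ Inl a) A"
proof -
  let ?S = "block_matrix A B C D"
  have W[measurable]: "(\<lambda>\<omega>. stack (X \<omega>) (Y \<omega>)) \<in> borel_measurable M"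
    and psd: "psd_matrix ?S"
    and D: "\<And>u. distr M borel (\<lambda>\<omega>. u \<bullet> stack (X \<omega>) (Y \<omega>)) = normal_law (u \<bullet> \<mu>) (u \<bullet> (?S *v u))"
    using assms by (auto simp: multivariate_normal_def)
  have fst: "(\<chi> a. stack x y $ Inl a) = x" for x :: "real ^ 'b" and y :: "real ^ 'c"
    by (simp add: stack_def)
  have blk: "(\<chi> a. (?S *v stack u 0) $ Inl a) = A *v u" for u
    by (simp add: vec_eq_iff matrix_vector_mult_def block_matrix_def stack_def
        UNIV_Plus_UNIV[symmetric] sum.Plus del: UNIV_Plus_UNIV)
  have quad: "stack u 0 \<bullet> (?S *v stack u 0) = u \<bullet> (A *v u)" for u
    by (simp add: inner_stack blk)
  have "X \<in> borel_measurable M"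
  proof -
    have "(\<lambda>\<omega>. stack (X \<omega>) (Y \<omega>) \<bullet> axis (Inl a) 1) \<in> borel_measurable M" for a
      by measurable
    then have "(\<lambda>\<omega>. X \<omega> \<bullet> axis a 1) \<in> borel_measurable M" for a
      by (simp add: stack_def inner_axis)
    then show ?thesis
      by (subst borel_measurable_euclidean_space) (auto simp: Basis_vec_def)
  qed
  moreover have "psd_matrix A"
  proof -
    have "transpose ?S $ Inl i $ Inl j = ?S $ Inl i $ Inl j" for i j
      using psd by (simp add: psd_matrix_def)
    then have "transpose A = A"
      by (simp add: transpose_def block_matrix_def vec_eq_iff)
    moreover have "0 \<le> u \<bullet> (A *v u)" for u
      using psd quad[of u] by (metis psd_matrix_def)
    ultimately show ?thesis by (simp add: psd_matrix_def)
  qed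
  moreover have "distr M borel (\<lambda>\<omega>. u \<bullet> X \<omega>) = normal_law (u \<bullet> (\<chi> a. \<mu> $ Inl a)) (u \<bullet> (A *v u))" for u
    using D[of "stack u 0"] fst unfolding quad inner_stack[of u 0] by simp
  ultimately show ?thesis by (simp add: multivariate_normal_def)
qed

section \<open>Radial integration and Gaussian moments\<close>

lemma nn_integral_lborel_scaleR:
  fixes f :: "'a::euclidean_space \<Rightarrow> ennreal"
  assumes [measurable]: "f \<in> borel_measurable borel" and c: "c \<noteq> 0"
  shows "(\<integral>\<^sup>+x. f x \<partial>lborel) = ennreal (\<bar>c\<bar> ^ DIM('a)) * (\<integral>\<^sup>+x. f (c *\<^sub>R x) \<partial>lborel)"
  by (subst lborel_affine[OF c, of 0])
     (simp add: nn_integral_density nn_integral_distr nn_integral_cmult)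

text \<open>
  Polar coordinates in the form needed here: the image of the measure \<open>f(x) dx\<close> under the norm has
  density proportional to \<open>r\<^sup>n\<^sup>-\<^sup>1\<close> with \<open>n = DIM('a) + d\<close>. By scaling, both measures give mass
  proportional to \<open>a\<^sup>n\<close> to the half-line below \<open>a\<close>, and such half-lines determine the measure. No surface measure
  on the sphere is involved; the angular part of \<open>f\<close> is hidden in the constant \<open>C\<close>.
\<close>

lemma homogeneous_radial_integral:
  fixes f :: "'a::euclidean_space \<Rightarrow> real"
  assumes f[measurable]: "f \<in> borel_measurable borel" and nn: "\<And>x. f x \<ge> 0"
    and hom: "\<And>c x. c > 0 \<Longrightarrow> f (c *\<^sub>R x) = c ^ d * f x"
    and bdd: "\<And>x. norm x \<le> 1 \<Longrightarrow> f x \<le> B"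
  obtains C where "C \<ge> 0" "\<And>g. g \<in> borel_measurable borel \<Longrightarrow>
    (\<integral>\<^sup>+x. ennreal (f x) * g (norm x) \<partial>lborel) =
      ennreal C * (\<integral>\<^sup>+r. ennreal (r ^ (DIM('a) + d - 1)) * indicator {0<..} r * g r \<partial>lborel)"
proof -
  define n where "n = DIM('a) + d"
  have n: "n > 0" by (simp add: n_def)
  define I where "I = (\<integral>\<^sup>+x. ennreal (f x) * indicator {x. norm x \<le> 1} x \<partial>(lborel :: 'a measure))"
  have "I \<le> (\<integral>\<^sup>+x. ennreal B * indicator {x. norm x \<le> 1} x \<partial>(lborel :: 'a measure))"
    unfolding I_def using bdd by (intro nn_integral_mono) (auto simp: indicator_def intro!: ennreal_leI)
  also have "\<dots> = ennreal B * emeasure lborel (cball (0::'a) 1)"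
    by (subst nn_integral_cmult_indicator) (auto simp: cball_def)
  also have "\<dots> < \<infinity>"
    using emeasure_lborel_cball_finite[of "0::'a" 1] by (simp add: ennreal_mult_less_top)
  finally have I: "I = ennreal (enn2real I)" by (simp add: ennreal_enn2real)
  \<comment> \<open>The density \<open>C r\<^sup>n\<^sup>-\<^sup>1\<close> has mass \<open>C / n\<close> on the unit interval, and this has to match the integral of \<open>f\<close> over the unit ball.\<close>
  define C where "C = real n * enn2real I"
  have C: "C \<ge> 0" by (simp add: C_def)
  define M1 where "M1 = distr (density lborel (\<lambda>x. ennreal (f x))) borel (norm :: 'a \<Rightarrow> real)"
  define M2 where "M2 = density lborel (\<lambda>r. ennreal C * (ennreal (r ^ (n - 1)) * indicator {0<..} r))"
  have M1: "emeasure M1 {..a} = ennreal (if a > 0 then a ^ n * enn2real I else 0)" for a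
  proof -
    have *: "emeasure M1 {..a} = (\<integral>\<^sup>+x. ennreal (f x) * indicator {x. norm x \<le> a} x \<partial>(lborel :: 'a measure))"
      unfolding M1_def by (subst emeasure_distr) (auto simp: emeasure_density vimage_def)
    show ?thesis
    proof (cases "a > 0")
      case True
      have "emeasure M1 {..a} = ennreal (a ^ DIM('a)) *
          (\<integral>\<^sup>+x. ennreal (f (a *\<^sub>R x)) * indicator {x. norm x \<le> a} (a *\<^sub>R x) \<partial>(lborel :: 'a measure))"
        unfolding * using True by (subst nn_integral_lborel_scaleR[of _ a]) auto
      also have "(\<lambda>x::'a. ennreal (f (a *\<^sub>R x)) * indicator {x. norm x \<le> a} (a *\<^sub>R x)) =
          (\<lambda>x. ennreal (a ^ d) * (ennreal (f x) * indicator {x. norm x \<le> 1} x))"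
        using True nn by (auto simp: hom ennreal_mult indicator_def fun_eq_iff mult.assoc mult_le_cancel_left1)
      also have "ennreal (a ^ DIM('a)) * (\<integral>\<^sup>+x. ennreal (a ^ d) * (ennreal (f x) * indicator {x. norm x \<le> 1} x) \<partial>(lborel :: 'a measure))
          = ennreal (a ^ DIM('a)) * (ennreal (a ^ d) * I)"
        unfolding I_def by (subst nn_integral_cmult) auto
      also have "\<dots> = ennreal (a ^ n * enn2real I)"
        using True by (subst I) (simp add: n_def power_add ennreal_mult mult.assoc)
      finally show ?thesis using True by simp
    next
      case False
      have "emeasure M1 {..a} = (\<integral>\<^sup>+x. 0 \<partial>(lborel :: 'a measure))"
        unfolding *
      proof (intro nn_integral_cong_AE)
        show "AE x in (lborel :: 'a measure). ennreal (f x) * indicator {x. norm x \<le> a} x = 0"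
          using AE_lborel_singleton[of "0::'a"]
        proof eventually_elim
          case (elim x)
          then have "norm x > 0" by simp
          then have "\<not> norm x \<le> a" using False by linarith
          then show ?case by simp
        qed
      qed
      then show ?thesis using False by simp
    qed
  qed
  have M2: "emeasure M2 {..a} = ennreal (if a > 0 then a ^ n * enn2real I else 0)" for a
  proof -
    have *: "emeasure M2 {..a} = (\<integral>\<^sup>+r. ennreal C * (ennreal (r ^ (n - 1)) * indicator {0<..} r) * indicator {..a} r \<partial>lborel)"
      unfolding M2_def by (subst emeasure_density) auto
    show ?thesis
    proof (cases "a > 0")
      case True
      have "emeasure M2 {..a} = (\<integral>\<^sup>+r. ennreal (C * r ^ (n - 1)) * indicator {0..a} r \<partial>lborel)"
        unfolding *
      proof (intro nn_integral_cong_AE)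
        show "AE r in lborel. ennreal C * (ennreal (r ^ (n - 1)) * indicator {0<..} r) * indicator {..a} r =
            ennreal (C * r ^ (n - 1)) * indicator {0..a} r"
          using AE_lborel_singleton[of "0::real"]
          by eventually_elim (use C in \<open>simp add: indicator_def ennreal_mult'\<close>)
      qed
      also have "\<dots> = ennreal (enn2real I * a ^ n - enn2real I * 0 ^ n)"
      proof (rule nn_integral_FTC_Icc)
        show "((\<lambda>r. enn2real I * r ^ n) has_real_derivative C * r ^ (n - 1)) (at r)" for r
          by (auto simp: C_def intro!: derivative_eq_intros)
      qed (use True C in auto)
      finally show ?thesis using True by (simp add: zero_power[OF n] mult.commute)
    next
      case False
      then have "emeasure M2 {..a} = (\<integral>\<^sup>+r. 0 \<partial>(lborel :: real measure))"
        unfolding * by (intro nn_integral_cong) (auto simp: indicator_def)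
      then show ?thesis using False by simp
    qed
  qed
  have "M1 = M2"
  proof (rule measure_eqI_generator_eq)
    show "Int_stable (range (\<lambda>a::real. {..a}))"
      by (auto simp: Int_stable_def min_def)
    show "sets M1 = sigma_sets UNIV (range (\<lambda>a::real. {..a}))"
      "sets M2 = sigma_sets UNIV (range (\<lambda>a::real. {..a}))"
      by (simp_all add: M1_def M2_def borel_eq_atMost)
    show "range (\<lambda>i. {..real i}) \<subseteq> range (\<lambda>a::real. {..a})" by auto
    show "(\<Union>i. {..real i}) = (UNIV :: real set)"
      by (auto simp: real_arch_simple)
    show "emeasure M1 X = emeasure M2 X" if "X \<in> range (\<lambda>a::real. {..a})" for X
      using that M1 M2 by auto
    show "emeasure M1 {..real i} \<noteq> \<infinity>" for i using M1 by simp
  qed auto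
  show thesis
  proof (rule that[OF C])
    fix g :: "real \<Rightarrow> ennreal" assume [measurable]: "g \<in> borel_measurable borel"
    have "(\<integral>\<^sup>+x. ennreal (f x) * g (norm x) \<partial>lborel) = (\<integral>\<^sup>+r. g r \<partial>M1)"
      unfolding M1_def by (simp add: nn_integral_distr nn_integral_density)
    also have "\<dots> = ennreal C * (\<integral>\<^sup>+r. ennreal (r ^ (n - 1)) * indicator {0<..} r * g r \<partial>lborel)"
      unfolding \<open>M1 = M2\<close> M2_def
      by (simp add: nn_integral_density nn_integral_cmult[symmetric] mult.assoc)
    finally show "(\<integral>\<^sup>+x. ennreal (f x) * g (norm x) \<partial>lborel) =
      ennreal C * (\<integral>\<^sup>+r. ennreal (r ^ (DIM('a) + d - 1)) * indicator {0<..} r * g r \<partial>lborel)"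
      by (simp add: n_def)
  qed
qed

text \<open>
  The two parities of \<open>m\<close> correspond to the half-integer and the integer values of the Gamma function.
\<close>

lemma nn_integral_power_gaussian:
  "(\<integral>\<^sup>+r. ennreal (r ^ m * exp (- r\<^sup>2)) * indicator {0<..} r \<partial>lborel) =
     ennreal (Gamma ((real m + 1) / 2) / 2)"
proof -
  have "has_bochner_integral lborel (\<lambda>r::real. indicator {0..} r *\<^sub>R (exp (- r\<^sup>2) * r ^ m))
      (Gamma ((real m + 1) / 2) / 2)"
  proof (cases "even m")
    case True
    then obtain k where m: "m = 2 * k" by (elim evenE)
    have "pochhammer (1/2::real) k = Gamma (1/2 + real k) / Gamma (1/2)"
      by (rule pochhammer_Gamma) (auto elim!: nonpos_Ints_cases)
    then have "Gamma (1/2 + real k) = sqrt pi * pochhammer (1/2) k"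
      by (simp add: Gamma_one_half_real)
    moreover have "(real m + 1) / 2 = 1/2 + real k" by (simp add: m)
    ultimately have "Gamma ((real m + 1) / 2) = sqrt pi * pochhammer (1/2) k" by (simp only:)
    then have eq: "Gamma ((real m + 1) / 2) / 2 = (sqrt pi / 2) * (fact (2 * k) / (2 ^ (2 * k) * fact k))"
      by (simp add: fact_double)
    show ?thesis unfolding eq unfolding m by (rule gaussian_moment_even_pos)
  next
    case False
    then obtain k where m: "m = 2 * k + 1" by (elim oddE)
    have "(real m + 1) / 2 = 1 + real k" by (simp add: m)
    then have eq: "Gamma ((real m + 1) / 2) / 2 = fact k / 2"
      by (simp only: Gamma_fact)
    show ?thesis unfolding eq unfolding m by (rule gaussian_moment_odd_pos)
  qed
  then have "(\<integral>\<^sup>+r. ennreal (indicator {0..} r *\<^sub>R (exp (- r\<^sup>2) * r ^ m)) \<partial>lborel) =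
      ennreal (Gamma ((real m + 1) / 2) / 2)"
    by (subst nn_integral_eq_integral) (auto simp: has_bochner_integral_iff indicator_def)
  moreover have "(\<integral>\<^sup>+r. ennreal (r ^ m * exp (- r\<^sup>2)) * indicator {0<..} r \<partial>lborel) =
      (\<integral>\<^sup>+r. ennreal (indicator {0..} r *\<^sub>R (exp (- r\<^sup>2) * r ^ m)) \<partial>lborel)"
  proof (intro nn_integral_cong_AE)
    show "AE r in lborel. ennreal (r ^ m * exp (- r\<^sup>2)) * indicator {0<..} r =
        ennreal (indicator {0..} r *\<^sub>R (exp (- r\<^sup>2) * r ^ m))"
      using AE_lborel_singleton[of "0::real"]
      by eventually_elim (simp add: indicator_def mult.commute)
  qed
  ultimately show ?thesis by simp
qed

text \<open>
  Both integrals are the same constant \<open>C\<close> of the radial law of \<open>f\<close> times a radial Gaussian moment, so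
  \<open>C\<close> cancels in the quotient. The condition on \<open>b\<close> is integrability at the origin.
\<close>

lemma homogeneous_gaussian_integral_norm_power:
  fixes f :: "'a::euclidean_space \<Rightarrow> real"
  assumes f[measurable]: "f \<in> borel_measurable borel" and nn: "\<And>x. f x \<ge> 0"
    and hom: "\<And>c x. c > 0 \<Longrightarrow> f (c *\<^sub>R x) = c ^ d * f x"
    and bdd: "\<And>x. norm x \<le> 1 \<Longrightarrow> f x \<le> B"
    and ab: "b < DIM('a) + d + a"
  shows "(\<integral>\<^sup>+x. ennreal (f x * (exp (- (norm x)\<^sup>2) * norm x ^ a / norm x ^ b)) \<partial>lborel) =
    ennreal (Gamma (real (DIM('a) + d + a - b) / 2) / Gamma (real (DIM('a) + d) / 2)) *
    (\<integral>\<^sup>+x. ennreal (f x * exp (- (norm x)\<^sup>2)) \<partial>lborel)"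
proof -
  obtain C where C: "C \<ge> 0" "\<And>g. g \<in> borel_measurable borel \<Longrightarrow>
    (\<integral>\<^sup>+x. ennreal (f x) * g (norm x) \<partial>lborel) =
      ennreal C * (\<integral>\<^sup>+r. ennreal (r ^ (DIM('a) + d - 1)) * indicator {0<..} r * g r \<partial>lborel)"
    by (rule homogeneous_radial_integral[OF f nn hom bdd]) (assumption+, rule that)
  have *: "(\<integral>\<^sup>+x. ennreal (f x * (exp (- (norm x)\<^sup>2) * norm x ^ i / norm x ^ j)) \<partial>lborel) =
      ennreal (C * (Gamma (real (DIM('a) + d + i - j) / 2) / 2))" if "j < DIM('a) + d + i" for i j
  proof -
    let ?m = "DIM('a) + d + i - j - 1"
    have "(\<integral>\<^sup>+x. ennreal (f x * (exp (- (norm x)\<^sup>2) * norm x ^ i / norm x ^ j)) \<partial>lborel) =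
        (\<integral>\<^sup>+x. ennreal (f x) * ennreal (exp (- (norm x)\<^sup>2) * norm x ^ i / norm x ^ j) \<partial>lborel)"
      using nn by (intro nn_integral_cong ennreal_mult')
    also have "\<dots> = ennreal C * (\<integral>\<^sup>+r. ennreal (r ^ (DIM('a) + d - 1)) * indicator {0<..} r *
        ennreal (exp (- r\<^sup>2) * r ^ i / r ^ j) \<partial>lborel)"
      by (rule C(2)) measurable
    also have "(\<lambda>r::real. ennreal (r ^ (DIM('a) + d - 1)) * indicator {0<..} r * ennreal (exp (- r\<^sup>2) * r ^ i / r ^ j)) =
        (\<lambda>r. ennreal (r ^ ?m * exp (- r\<^sup>2)) * indicator {0<..} r)"
    proof
      fix r :: real
      show "ennreal (r ^ (DIM('a) + d - 1)) * indicator {0<..} r * ennreal (exp (- r\<^sup>2) * r ^ i / r ^ j) =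
        ennreal (r ^ ?m * exp (- r\<^sup>2)) * indicator {0<..} r"
      proof (cases "r > 0")
        case True
        have "DIM('a) \<ge> 1" by (simp add: Suc_leI)
        then have "(DIM('a) + d - 1) + i = ?m + j" using that by linarith
        then have "r ^ (DIM('a) + d - 1) * r ^ i = r ^ ?m * r ^ j"
          by (metis power_add)
        then have "r ^ (DIM('a) + d - 1) * (exp (- r\<^sup>2) * r ^ i / r ^ j) = r ^ ?m * exp (- r\<^sup>2)"
          using True by (simp add: field_simps)
        then show ?thesis using True by (simp add: ennreal_mult[symmetric])
      qed simp
    qed
    also have "ennreal C * (\<integral>\<^sup>+r. ennreal (r ^ ?m * exp (- r\<^sup>2)) * indicator {0<..} r \<partial>lborel) =
        ennreal (C * (Gamma (real (DIM('a) + d + i - j) / 2) / 2))"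
    proof -
      have "real (N - 1) + 1 = real N" if "N > 0" for N :: nat
        using that by (simp add: of_nat_diff Suc_leI)
      from this[of "DIM('a) + d + i - j"] show ?thesis
        unfolding nn_integral_power_gaussian using that by (simp only: ennreal_mult'[OF C(1)] zero_less_diff)
    qed
    finally show ?thesis .
  qed
  have G: "Gamma (real (DIM('a) + d) / 2) > 0" "Gamma (real (DIM('a) + d + a - b) / 2) > 0"
    using ab by (auto intro!: Gamma_real_pos simp: add_pos_nonneg)
  show ?thesis
    unfolding *[OF ab] using *[of 0 0] C(1) G
    by (simp add: ennreal_mult'[symmetric])
qed

lemma nn_integral_gaussian_exponential_1d:
  "(\<integral>\<^sup>+(x::real). ennreal (exp (- x\<^sup>2 + x * c)) \<partial>lborel) = ennreal (sqrt pi * exp (c\<^sup>2 / 4))"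
proof -
  have eq: "exp (- x\<^sup>2 + x * c) = sqrt pi * exp (c\<^sup>2 / 4) * normal_density (c/2) (1 / sqrt 2) x" for x
  proof -
    have "- x\<^sup>2 + x * c = c\<^sup>2 / 4 + - (x - c/2)\<^sup>2" by (simp add: power2_eq_square field_simps)
    then have "exp (- x\<^sup>2 + x * c) = exp (c\<^sup>2 / 4) * exp (- (x - c/2)\<^sup>2)" by (simp add: exp_add[symmetric])
    then show ?thesis by (simp add: normal_density_def power_divide)
  qed
  have "(\<integral>\<^sup>+(x::real). ennreal (exp (- x\<^sup>2 + x * c)) \<partial>lborel) =
      ennreal (\<integral>x. sqrt pi * exp (c\<^sup>2 / 4) * normal_density (c/2) (1 / sqrt 2) x \<partial>lborel)"
    unfolding eq by (intro nn_integral_eq_integral) auto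
  then show ?thesis by simp
qed

text \<open>
  The moment generating function of the weight \<open>exp (- |s|\<^sup>2)\<close>; the integrand factors over the
  coordinates.
\<close>

lemma nn_integral_gaussian_exponential:
  fixes t :: "'a::euclidean_space"
  shows "(\<integral>\<^sup>+s. ennreal (exp (- (norm s)\<^sup>2 + s \<bullet> t)) \<partial>lborel) =
    ennreal (pi powr (real DIM('a) / 2) * exp ((norm t)\<^sup>2 / 4))"
proof -
  have nrm: "(norm s)\<^sup>2 = (\<Sum>b\<in>Basis. (s \<bullet> b)\<^sup>2)" for s :: 'a
    unfolding power2_norm_eq_inner by (subst euclidean_inner) (simp add: power2_eq_square)
  have "exp (- (norm s)\<^sup>2 + s \<bullet> t) = (\<Prod>b\<in>Basis. exp (- (s \<bullet> b)\<^sup>2 + (s \<bullet> b) * (t \<bullet> b)))" for s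
    by (simp add: nrm euclidean_inner[of s t] exp_sum[symmetric] sum_subtractf)
  then have "(\<integral>\<^sup>+s. ennreal (exp (- (norm s)\<^sup>2 + s \<bullet> t)) \<partial>lborel) =
      (\<integral>\<^sup>+s. (\<Prod>b\<in>Basis. ennreal (exp (- (s \<bullet> b)\<^sup>2 + (s \<bullet> b) * (t \<bullet> b)))) \<partial>lborel)"
    by (simp add: prod_ennreal)
  also have "\<dots> = (\<Prod>b\<in>Basis. \<integral>\<^sup>+x. ennreal (exp (- x\<^sup>2 + x * (t \<bullet> b))) \<partial>lborel)"
    by (rule nn_integral_lborel_prod[where f = "\<lambda>b x. ennreal (exp (- x\<^sup>2 + x * (t \<bullet> b)))"]) auto
  also have "\<dots> = (\<Prod>b\<in>Basis. ennreal (sqrt pi * exp ((t \<bullet> b)\<^sup>2 / 4)))"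
    by (simp only: nn_integral_gaussian_exponential_1d)
  also have "\<dots> = ennreal (sqrt pi ^ DIM('a) * exp ((norm t)\<^sup>2 / 4))"
    by (simp add: prod_ennreal prod.distrib exp_sum[symmetric] nrm sum_divide_distrib)
  also have "sqrt pi ^ DIM('a) = pi powr (real DIM('a) / 2)"
    by (simp add: powr_half_sqrt[symmetric] powr_realpow[symmetric] powr_powr)
  finally show ?thesis .
qed

text \<open>
  Only positive arguments are available when comparing generating functions of nonnegative terms, so
  the identity theorem is needed from one side of \<open>0\<close>. The lowest coefficient is the limit at \<open>0\<close>;
  the others follow after dividing by a power of \<open>y\<close>.
\<close>

lemma powser_zero_imp_coeffs_zero:
  fixes a :: "nat \<Rightarrow> real"
  assumes "\<And>y. y > 0 \<Longrightarrow> (\<lambda>k. a k * y ^ k) sums 0"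
  shows "a k = 0"
proof -
  have zero: "b 0 = 0" if b: "\<And>y. y > 0 \<Longrightarrow> (\<lambda>k. b k * y ^ k) sums 0" for b :: "nat \<Rightarrow> real"
  proof -
    have sm: "summable (\<lambda>k. b k * x ^ k)" for x
      by (rule powser_inside[OF sums_summable[OF b[of "\<bar>x\<bar> + 1"]]]) auto
    have "((\<lambda>x. \<Sum>k. b k * x ^ k) \<longlongrightarrow> b 0) (at 0)"
      by (rule powser_limit_0[of 1]) (auto intro!: summable_sums sm)
    then have "((\<lambda>x. \<Sum>k. b k * x ^ k) \<longlongrightarrow> b 0) (at_right 0)"
      by (rule tendsto_mono[rotated]) (simp add: at_le)
    moreover have "((\<lambda>x. \<Sum>k. b k * x ^ k) \<longlongrightarrow> 0) (at_right 0)"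
      by (rule Lim_transform_eventually[OF tendsto_const])
        (use b in \<open>auto simp: eventually_at_right_less sums_iff intro!: eventually_mono[OF eventually_at_right_less]\<close>)
    ultimately show ?thesis
      using tendsto_unique by force
  qed
  show ?thesis
  proof (induction k rule: less_induct)
    case (less k)
    have "(\<lambda>j. a (j + k) * y ^ j) sums 0" if "y > 0" for y
    proof -
      have "(\<lambda>j. a (j + k) * y ^ (j + k)) sums (0 - (\<Sum>j<k. a j * y ^ j))"
        using assms[OF that] by (rule sums_split_initial_segment)
      then have "(\<lambda>j. a (j + k) * y ^ (j + k) / y ^ k) sums (0 / y ^ k)"
        using less by (intro sums_divide) simp
      then show ?thesis using that by (simp add: power_add)
    qed
    from zero[of "\<lambda>j. a (j + k)", OF this] show ?case by simp
  qed
qed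

lemma ennreal_average:
  assumes "a \<ge> 0" "b \<ge> 0"
  shows "ennreal (1/2) * ennreal a + ennreal (1/2) * ennreal b = ennreal ((a + b) / 2)"
proof -
  have "ennreal ((a + b) / 2) = ennreal (1/2 * a + 1/2 * b)" by (simp add: add_divide_distrib)
  also have "\<dots> = ennreal (1/2 * a) + ennreal (1/2 * b)" using assms by (intro ennreal_plus) auto
  also have "\<dots> = ennreal (1/2) * ennreal a + ennreal (1/2) * ennreal b"
    by (intro arg_cong2[where f = "(+)"] ennreal_mult') auto
  finally show ?thesis ..
qed

lemma cosh_sums: "(\<lambda>k. x ^ (2 * k) / fact (2 * k)) sums cosh (x::real)"
proof -
  have "(\<lambda>k. (\<lambda>n. if even n then x ^ n /\<^sub>R fact n else 0) (2 * k)) sums cosh x"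
    using cosh_converges[of x]
    by (subst sums_mono_reindex) (auto simp: strict_mono_def elim!: evenE)
  then show ?thesis by (simp add: field_simps)
qed

text \<open>
  Replacing \<open>t\<close> by \<open>\<surd>y t\<close> in the moment generating function and symmetrising it to a hyperbolic cosine
  exhibits the moments as coefficients of a power series in \<open>y\<close>, which is also the exponential series
  for \<open>exp (y |t|\<^sup>2 / 4)\<close>.
\<close>

lemma nn_integral_gaussian_moment:
  fixes t :: "'a::euclidean_space"
  shows "(\<integral>\<^sup>+s. ennreal ((s \<bullet> t) ^ (2 * k) * exp (- (norm s)\<^sup>2)) \<partial>lborel) =
    ennreal (pi powr (real DIM('a) / 2) * fact (2 * k) / (4 ^ k * fact k) * norm t ^ (2 * k))"
proof -
  define m where "m k = (\<integral>\<^sup>+s. ennreal ((s \<bullet> t) ^ (2 * k) * exp (- (norm s)\<^sup>2)) \<partial>lborel)" for k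
  define P where "P = pi powr (real DIM('a) / 2)"
  define z where "z = (norm t)\<^sup>2 / 4"
  have P: "P > 0" by (simp add: P_def)
  have gen: "(\<Sum>k. ennreal (y ^ k / fact (2 * k)) * m k) = ennreal (P * exp (y * z))"
    if "y > 0" for y
  proof -
    have "(\<Sum>k. ennreal (y ^ k / fact (2 * k)) * m k) =
        (\<Sum>k. \<integral>\<^sup>+s. ennreal (y ^ k / fact (2 * k)) * ennreal ((s \<bullet> t) ^ (2 * k) * exp (- (norm s)\<^sup>2)) \<partial>lborel)"
      unfolding m_def by (subst nn_integral_cmult) auto
    also have "\<dots> = (\<integral>\<^sup>+s. (\<Sum>k. ennreal (y ^ k / fact (2 * k)) * ennreal ((s \<bullet> t) ^ (2 * k) * exp (- (norm s)\<^sup>2))) \<partial>lborel)"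
      by (rule nn_integral_suminf[symmetric]) measurable
    also have "\<dots> = (\<integral>\<^sup>+s. ennreal (1/2) * ennreal (exp (- (norm s)\<^sup>2 + s \<bullet> (sqrt y *\<^sub>R t))) +
        ennreal (1/2) * ennreal (exp (- (norm s)\<^sup>2 + s \<bullet> (- sqrt y *\<^sub>R t))) \<partial>lborel)"
    proof (rule nn_integral_cong)
      fix s :: 'a
      have root: "sqrt y ^ (2 * k) = y ^ k" for k using that by (simp add: power_mult)
      have "(\<lambda>k. (sqrt y * (s \<bullet> t)) ^ (2 * k) / fact (2 * k) * exp (- (norm s)\<^sup>2)) sums
          (cosh (sqrt y * (s \<bullet> t)) * exp (- (norm s)\<^sup>2))"
        by (intro sums_mult2 cosh_sums)
      also have "(\<lambda>k. (sqrt y * (s \<bullet> t)) ^ (2 * k) / fact (2 * k) * exp (- (norm s)\<^sup>2)) =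
          (\<lambda>k. y ^ k / fact (2 * k) * ((s \<bullet> t) ^ (2 * k) * exp (- (norm s)\<^sup>2)))"
        using root by (simp add: power_mult_distrib mult.assoc)
      finally have sm: "(\<lambda>k. y ^ k / fact (2 * k) * ((s \<bullet> t) ^ (2 * k) * exp (- (norm s)\<^sup>2))) sums
          (cosh (sqrt y * (s \<bullet> t)) * exp (- (norm s)\<^sup>2))" .
      have "(\<Sum>k. ennreal (y ^ k / fact (2 * k)) * ennreal ((s \<bullet> t) ^ (2 * k) * exp (- (norm s)\<^sup>2))) =
          (\<Sum>k. ennreal (y ^ k / fact (2 * k) * ((s \<bullet> t) ^ (2 * k) * exp (- (norm s)\<^sup>2))))"
        using that by (intro suminf_cong ennreal_mult'[symmetric]) simp
      also have "\<dots> = ennreal (cosh (sqrt y * (s \<bullet> t)) * exp (- (norm s)\<^sup>2))"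
        using sm that by (intro suminf_ennreal_eq) (auto simp: power_mult)
      also have "cosh (sqrt y * (s \<bullet> t)) * exp (- (norm s)\<^sup>2) =
          (exp (- (norm s)\<^sup>2 + s \<bullet> (sqrt y *\<^sub>R t)) + exp (- (norm s)\<^sup>2 + s \<bullet> (- sqrt y *\<^sub>R t))) / 2"
        by (simp add: cosh_field_def exp_add exp_diff field_simps exp_minus)
      finally show "(\<Sum>k. ennreal (y ^ k / fact (2 * k)) * ennreal ((s \<bullet> t) ^ (2 * k) * exp (- (norm s)\<^sup>2))) =
        ennreal (1/2) * ennreal (exp (- (norm s)\<^sup>2 + s \<bullet> (sqrt y *\<^sub>R t))) +
        ennreal (1/2) * ennreal (exp (- (norm s)\<^sup>2 + s \<bullet> (- sqrt y *\<^sub>R t)))"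
        by (subst ennreal_average) auto
    qed
    also have "\<dots> = ennreal (1/2) * ennreal (P * exp (y * z)) +
        ennreal (1/2) * ennreal (P * exp (y * z))"
    proof -
      have mgf: "(\<integral>\<^sup>+s. ennreal (exp (- (norm s)\<^sup>2 + s \<bullet> (c *\<^sub>R t))) \<partial>lborel) =
          ennreal (P * exp (y * z))" if "c\<^sup>2 = y" for c
        using nn_integral_gaussian_exponential[of "c *\<^sub>R t"] that by (simp add: P_def z_def power_mult_distrib)
      have "(sqrt y)\<^sup>2 = y" "(- sqrt y)\<^sup>2 = y" using that by simp_all
      note mgf = this[THEN mgf]
      show ?thesis
        by (subst nn_integral_add, measurable, subst nn_integral_cmult, measurable,
            subst nn_integral_cmult, measurable) (simp only: mgf)
    qed
    also have "\<dots> = ennreal (P * exp (y * z))"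
      using P by (subst ennreal_average) auto
    finally show ?thesis .
  qed
  \<comment> \<open>Each moment is finite because the series of all of them converges at \<open>y = 1\<close>.\<close>
  have fin: "m k < \<infinity>" for k
  proof -
    have "(\<Sum>k. ennreal (1 ^ k / fact (2 * k)) * m k) < \<infinity>"
      using gen[of 1] by simp
    from ennreal_suminf_lessD[OF this, of k] show ?thesis
      by (auto simp: ennreal_mult_less_top)
  qed
  define r where "r k = enn2real (m k)" for k
  have r: "m k = ennreal (r k)" "r k \<ge> 0" for k
    using fin[of k] by (auto simp: r_def)
  define a where "a k = r k / fact (2 * k) - P * z ^ k / fact k" for k
  have "a k = 0"
  proof (rule powser_zero_imp_coeffs_zero)
    fix y :: real assume y: "y > 0"
    have "(\<lambda>k. y ^ k / fact (2 * k) * r k) sums (P * exp (y * z))"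
    proof -
      have nn: "0 \<le> y ^ k / fact (2 * k) * r k" for k
        using y r by simp
      have eq: "(\<Sum>k. ennreal (y ^ k / fact (2 * k) * r k)) = ennreal (P * exp (y * z))"
        using gen[OF y] y r by (simp add: ennreal_mult'[symmetric])
      then have sm: "summable (\<lambda>k. y ^ k / fact (2 * k) * r k)"
        by (intro summable_suminf_not_top nn) simp
      have "ennreal (\<Sum>k. y ^ k / fact (2 * k) * r k) = ennreal (P * exp (y * z))"
        using suminf_ennreal_eq[OF nn summable_sums[OF sm]] eq by simp
      then have "(\<Sum>k. y ^ k / fact (2 * k) * r k) = P * exp (y * z)"
        using P suminf_nonneg[OF sm nn] by simp
      then show ?thesis using sm by (simp add: sums_iff)
    qed
    moreover have "(\<lambda>k. P * ((y * z) ^ k / fact k)) sums (P * exp (y * z))"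
      using exp_converges[of "y * z"] by (intro sums_mult) (simp add: field_simps)
    ultimately have "(\<lambda>k. y ^ k / fact (2 * k) * r k - P * ((y * z) ^ k / fact k)) sums 0"
      using sums_diff by fastforce
    then show "(\<lambda>k. a k * y ^ k) sums 0"
      by (simp add: a_def power_mult_distrib algebra_simps)
  qed
  then have "r k = P * fact (2 * k) / (4 ^ k * fact k) * norm t ^ (2 * k)"
    by (simp add: a_def z_def power_divide power_mult[symmetric] field_simps)
  then show ?thesis using r(1)[of k] by (simp add: m_def P_def)
qed

section \<open>Gauss's summation theorem with upper parameters \<open>-1/2, -1/2\<close>\<close>

text \<open>
  The \<open>k\<close>-th coefficient of the Gauss series with parameters \<open>-1/2, -1/2; c\<close>. Both upper parameters
  agree, so the coefficients are nonnegative for \<open>c > 0\<close>.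
\<close>

definition gauss_coeff :: "real \<Rightarrow> nat \<Rightarrow> real" where
  "gauss_coeff c k = (pochhammer (-1/2) k)\<^sup>2 / (pochhammer c k * fact k)"

lemma gauss_coeff_0 [simp]: "gauss_coeff c 0 = 1"
  by (simp add: gauss_coeff_def)

lemma gauss_coeff_nonneg: "c > 0 \<Longrightarrow> gauss_coeff c k \<ge> 0"
  by (simp add: gauss_coeff_def pochhammer_nonneg)

lemma gauss_coeff_Suc:
  assumes "c > 0"
  shows "(real k + 1) * gauss_coeff c (Suc k) = (real k - 1/2)\<^sup>2 / (c + real k) * gauss_coeff c k"
proof -
  have p: "pochhammer (-1/2) (Suc k) = (real k - 1/2) * pochhammer (-1/2) k"
    "pochhammer c (Suc k) = (c + real k) * pochhammer c k"
    "fact (Suc k) = (real k + 1) * fact k"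
    by (simp_all add: pochhammer_rec' add.commute)
  have "pochhammer c k \<noteq> 0" "c + real k \<noteq> 0" "real k + 1 \<noteq> 0"
    using assms pochhammer_pos[OF assms, of k] by auto
  then show ?thesis
    unfolding gauss_coeff_def p by (simp add: power_mult_distrib)
qed

text \<open>
  This difference serves twice: it dominates a multiple of the \<open>k\<close>-th term, which gives summability
  (\<open>gauss_coeff_le\<close>), and it is a linear combination of the terms for \<open>c\<close> and \<open>c + 1\<close>, which gives
  the contiguous relation (\<open>gauss_sum_contiguous\<close>).
\<close>

lemma gauss_coeff_telescope:
  assumes "c > 0"
  shows "real k * gauss_coeff c k - (real k + 1) * gauss_coeff c (Suc k) =
           (real k * (c + 1) - 1/4) / (c + real k) * gauss_coeff c k"
  using assms unfolding gauss_coeff_Suc[OF assms] by (simp add: field_simps power2_eq_square)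

lemma gauss_coeff_shift:
  assumes "c > 0"
  shows "gauss_coeff (c + 1) k = c / (c + real k) * gauss_coeff c k"
  using assms pochhammer_pos[OF assms, of k] pochhammer_pos[of "c + 1" k]
    pochhammer_rec[of c k] pochhammer_rec'[of c k]
  by (simp add: gauss_coeff_def field_simps)

lemma gauss_coeff_le:
  assumes "c > 0"
  shows "gauss_coeff c (Suc k) \<le> 2 * (real (Suc k) * gauss_coeff c (Suc k)
           - real (Suc (Suc k)) * gauss_coeff c (Suc (Suc k)))"
proof -
  have "1/2 \<le> (real (Suc k) * (c + 1) - 1/4) / (c + real (Suc k))"
    using assms by (simp add: field_simps)
  then have "1/2 * gauss_coeff c (Suc k) \<le>
      (real (Suc k) * (c + 1) - 1/4) / (c + real (Suc k)) * gauss_coeff c (Suc k)"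
    by (rule mult_right_mono) (rule gauss_coeff_nonneg[OF assms])
  then have "1/2 * gauss_coeff c (Suc k) \<le>
      real (Suc k) * gauss_coeff c (Suc k) - real (Suc (Suc k)) * gauss_coeff c (Suc (Suc k))"
    unfolding gauss_coeff_telescope[OF assms, of "Suc k", symmetric] of_nat_Suc[of "Suc k"]
    by (simp only: add.commute)
  then show ?thesis by simp
qed

lemma gauss_coeff_partial_sums:
  assumes "c > 0"
  shows "(\<Sum>k<n. gauss_coeff c (Suc k)) \<le> 1 / (2 * c)"
proof -
  have "(\<Sum>k<n. gauss_coeff c (Suc k)) \<le> (\<Sum>k<n. 2 * (real (Suc k) * gauss_coeff c (Suc k)
           - real (Suc (Suc k)) * gauss_coeff c (Suc (Suc k))))"
    by (intro sum_mono gauss_coeff_le assms)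
  also have "\<dots> = 2 * (gauss_coeff c 1 - real (Suc n) * gauss_coeff c (Suc n))"
    unfolding sum_distrib_left[symmetric] by (subst sum_lessThan_telescope') simp
  also have "\<dots> \<le> 2 * gauss_coeff c 1"
    using gauss_coeff_nonneg[OF assms, of "Suc n"] by simp
  also have "\<dots> = 1 / (2 * c)"
    by (simp add: gauss_coeff_def power2_eq_square)
  finally show ?thesis .
qed

lemma gauss_coeff_summable:
  assumes "c > 0"
  shows "summable (gauss_coeff c)"
proof -
  have "summable (\<lambda>k. gauss_coeff c (Suc k))"
    using gauss_coeff_nonneg[OF assms] gauss_coeff_partial_sums[OF assms]
    by (intro bounded_imp_summable) (auto simp: lessThan_Suc_atMost[symmetric] simp del: sum.lessThan_Suc)
  then show ?thesis by (simp only: summable_Suc_iff)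
qed

text \<open>
  The tail bound \<open>1 / (2 c)\<close> shows that the sum tends to \<open>1\<close> as \<open>c\<close> grows, which ends the iteration of
  the contiguous relation.
\<close>

lemma gauss_coeff_suminf_bounds:
  assumes "c > 0"
  shows "1 \<le> suminf (gauss_coeff c)" "suminf (gauss_coeff c) \<le> 1 + 1 / (2 * c)"
proof -
  have s: "summable (\<lambda>k. gauss_coeff c (Suc k))"
    using gauss_coeff_summable[OF assms] by (simp only: summable_Suc_iff)
  have eq: "suminf (gauss_coeff c) = 1 + (\<Sum>k. gauss_coeff c (Suc k))"
    using suminf_split_head[OF gauss_coeff_summable[OF assms]] by simp
  show "1 \<le> suminf (gauss_coeff c)"
    using suminf_nonneg[OF s] gauss_coeff_nonneg[OF assms] by (simp add: eq)
  show "suminf (gauss_coeff c) \<le> 1 + 1 / (2 * c)"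
    using suminf_le_const[OF s gauss_coeff_partial_sums[OF assms]] by (simp add: eq)
qed

text \<open>
  The sequence is decreasing from index \<open>1\<close> on, so it has a limit; a positive limit would make the
  summable terms dominate a harmonic series.
\<close>

lemma gauss_coeff_times_index_tendsto_0:
  assumes "c > 0"
  shows "(\<lambda>k. real k * gauss_coeff c k) \<longlonglongrightarrow> 0"
proof -
  define u where "u k = real (Suc k) * gauss_coeff c (Suc k)" for k
  have dec: "u (Suc k) \<le> u k" for k
    using gauss_coeff_le[OF assms, of k] gauss_coeff_nonneg[OF assms, of "Suc k"]
    by (simp add: u_def)
  have nn: "0 \<le> u k" for k
    using gauss_coeff_nonneg[OF assms] by (simp add: u_def)
  obtain L where L: "u \<longlonglongrightarrow> L" "\<And>k. L \<le> u k"
    using decseq_convergent[of u 0, OF decseq_SucI] dec nn by blast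
  have "L \<ge> 0" using L nn by (intro LIMSEQ_le_const[OF L(1)]) auto
  \<comment> \<open>A positive lower bound \<open>L\<close> of \<open>k a\<^sub>k\<close> would give \<open>a\<^sub>k \<ge> L / k\<close>.\<close>
  have "L = 0"
  proof (rule ccontr)
    assume "L \<noteq> 0"
    have "summable (\<lambda>k. L * inverse (real (Suc k)))"
    proof (rule summable_comparison_test')
      show "summable (\<lambda>k. gauss_coeff c (Suc k))"
        using gauss_coeff_summable[OF assms] by (simp only: summable_Suc_iff)
      show "norm (L * inverse (real (Suc k))) \<le> gauss_coeff c (Suc k)" if "k \<ge> 0" for k
        using L(2)[of k] \<open>L \<ge> 0\<close> by (simp add: u_def field_simps)
    qed
    then show False
      using \<open>L \<noteq> 0\<close> not_summable_harmonic[where 'a = real]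
      by (simp add: summable_cmult_iff summable_Suc_iff[of "\<lambda>k. inverse (real k)"] del: of_nat_Suc)
  qed
  then show ?thesis
    using L(1) filterlim_sequentially_Suc[of "\<lambda>k. real k * gauss_coeff c k"]
    by (simp add: u_def[abs_def])
qed

text \<open>
  Summing the telescoping identity, whose boundary terms vanish.
\<close>

lemma gauss_sum_contiguous:
  assumes "c > 0"
  shows "suminf (gauss_coeff c) = (c + 1/2)\<^sup>2 / (c * (c + 1)) * suminf (gauss_coeff (c + 1))"
proof -
  have S: "summable (gauss_coeff c)" "summable (gauss_coeff (c + 1))"
    using assms by (auto intro: gauss_coeff_summable)
  have eq: "real k * gauss_coeff c k - real (Suc k) * gauss_coeff c (Suc k) =
      (c + 1) * gauss_coeff c k - (c + 1/2)\<^sup>2 / c * gauss_coeff (c + 1) k" for k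
  proof -
    have "(real k * (c + 1) - 1/4) / (c + real k) = (c + 1) - (c + 1/2)\<^sup>2 / c * (c / (c + real k))"
      using assms add_pos_nonneg[OF assms, of "real k"]
      by (simp add: divide_simps power2_eq_square) (simp add: algebra_simps)
    then have "(real k * (c + 1) - 1/4) / (c + real k) * gauss_coeff c k =
        (c + 1) * gauss_coeff c k - (c + 1/2)\<^sup>2 / c * gauss_coeff (c + 1) k"
      by (simp only: gauss_coeff_shift[OF assms] left_diff_distrib mult.assoc)
    then show ?thesis
      using gauss_coeff_telescope[OF assms, of k] by (simp add: add.commute)
  qed
  have "(\<lambda>k. real k * gauss_coeff c k - real (Suc k) * gauss_coeff c (Suc k)) sums (real 0 * gauss_coeff c 0 - 0)"
    by (rule telescope_sums'[OF gauss_coeff_times_index_tendsto_0[OF assms]])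
  then have "(\<lambda>k. (c + 1) * gauss_coeff c k - (c + 1/2)\<^sup>2 / c * gauss_coeff (c + 1) k) sums 0"
    unfolding eq by simp
  moreover have "(\<lambda>k. (c + 1) * gauss_coeff c k - (c + 1/2)\<^sup>2 / c * gauss_coeff (c + 1) k) sums
      ((c + 1) * suminf (gauss_coeff c) - (c + 1/2)\<^sup>2 / c * suminf (gauss_coeff (c + 1)))"
    by (intro sums_diff sums_mult summable_sums S)
  ultimately have "(c + 1) * suminf (gauss_coeff c) = (c + 1/2)\<^sup>2 / c * suminf (gauss_coeff (c + 1))"
    using sums_unique2 by fastforce
  then have "(c + 1) * suminf (gauss_coeff c) / (c + 1) =
      (c + 1/2)\<^sup>2 / c * suminf (gauss_coeff (c + 1)) / (c + 1)"
    by (rule arg_cong)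
  then show ?thesis using assms by simp
qed

lemma gauss_sum_iterate:
  assumes "c > 0"
  shows "suminf (gauss_coeff c) =
    (pochhammer (c + 1/2) n)\<^sup>2 / (pochhammer c n * pochhammer (c + 1) n) * suminf (gauss_coeff (c + real n))"
proof (induction n)
  case (Suc n)
  have "suminf (gauss_coeff (c + real n)) =
    (c + real n + 1/2)\<^sup>2 / ((c + real n) * (c + real n + 1)) * suminf (gauss_coeff (c + real (Suc n)))"
    using gauss_sum_contiguous[of "c + real n"] assms by (simp add: add_ac)
  then show ?case
    unfolding Suc.IH by (simp add: pochhammer_rec' power_mult_distrib power_divide add_ac mult_ac)
qed simp

text \<open>
  Iterating the contiguous relation pushes \<open>c\<close> to infinity, where the sum is \<open>1\<close>. The accumulated
  quotient of Pochhammer symbols converges to Gamma values by Euler's limit formula, in which the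
  exponential factors cancel because \<open>2 (c + 1/2) = c + (c + 1)\<close>.
\<close>

theorem gauss_sum_minus_half:
  assumes "c > 0"
  shows "gauss_coeff c sums (Gamma c * Gamma (c + 1) / (Gamma (c + 1/2))\<^sup>2)"
proof -
  have ni: "z \<notin> \<int>\<^sub>\<le>\<^sub>0" if "z > 0" for z :: real using that by (auto elim!: nonpos_Ints_cases)
  define r where "r n = (pochhammer (c + 1/2) (Suc n))\<^sup>2 / (pochhammer c (Suc n) * pochhammer (c + 1) (Suc n))" for n
  have "r \<longlonglongrightarrow> (rGamma (c + 1/2))\<^sup>2 / (rGamma c * rGamma (c + 1))"
  proof (rule Lim_transform_eventually)
    show "(\<lambda>n. (rGamma_series (c + 1/2) n)\<^sup>2 / (rGamma_series c n * rGamma_series (c + 1) n))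
        \<longlonglongrightarrow> (rGamma (c + 1/2))\<^sup>2 / (rGamma c * rGamma (c + 1))"
      using assms by (intro tendsto_intros) (auto simp: rGamma_eq_zero_iff ni)
    have "exp ((c + 1/2) * L)^2 = exp (c * L) * exp ((c + 1) * L)" for L :: real
      by (simp add: exp_add[symmetric] exp_double[symmetric] algebra_simps)
    then show "\<forall>\<^sub>F n in sequentially. (rGamma_series (c + 1/2) n)\<^sup>2 /
        (rGamma_series c n * rGamma_series (c + 1) n) = r n"
      by (intro always_eventually) (simp add: rGamma_series_def r_def power_divide power_mult_distrib
          power2_eq_square[of "fact _"])
  qed
  moreover have "(\<lambda>n. suminf (gauss_coeff (c + real (Suc n)))) \<longlonglongrightarrow> 1"
  proof (rule tendsto_sandwich)
    have pos: "c + real (Suc n) > 0" for n using assms by simp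
    show "\<forall>\<^sub>F n in sequentially. 1 \<le> suminf (gauss_coeff (c + real (Suc n)))"
      using gauss_coeff_suminf_bounds(1)[OF pos] by (intro always_eventually allI)
    show "\<forall>\<^sub>F n in sequentially. suminf (gauss_coeff (c + real (Suc n))) \<le> 1 + 1 / (2 * (c + real (Suc n)))"
      using gauss_coeff_suminf_bounds(2)[OF pos] by (intro always_eventually allI)
    show "(\<lambda>n. 1 + 1 / (2 * (c + real (Suc n)))) \<longlonglongrightarrow> 1" by real_asymp
  qed simp
  ultimately have "(\<lambda>n. r n * suminf (gauss_coeff (c + real (Suc n)))) \<longlonglongrightarrow>
      (rGamma (c + 1/2))\<^sup>2 / (rGamma c * rGamma (c + 1)) * 1"
    by (intro tendsto_mult)
  moreover have "(\<lambda>n. r n * suminf (gauss_coeff (c + real (Suc n)))) = (\<lambda>n. suminf (gauss_coeff c))"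
    unfolding r_def by (subst gauss_sum_iterate[OF assms, symmetric]) simp
  ultimately have "suminf (gauss_coeff c) = (rGamma (c + 1/2))\<^sup>2 / (rGamma c * rGamma (c + 1))"
    by (simp add: LIMSEQ_const_iff)
  then show ?thesis
    using gauss_coeff_summable[OF assms] by (simp add: sums_iff Gamma_def field_simps)
qed

text \<open>
  The two Gauss series are subtracted termwise. The terms with \<open>k = 0\<close> contribute \<open>1 - 2 = -1\<close>, which
  the summand \<open>1\<close> of \<open>A_const\<close> removes.
\<close>

lemma A_const_sums:
  assumes "p > 0"
  shows "(\<lambda>k. (1 - 2 / 4 ^ Suc k) * gauss_coeff (real p / 2) (Suc k)) sums A_const p"
proof -
  define c where "c = real p / 2"
  have c: "c > 0" using assms by (simp add: c_def)
  have "summable (\<lambda>k. gauss_coeff c k * (1/4) ^ k)"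
  proof (rule summable_comparison_test'[OF gauss_coeff_summable[OF c]])
    show "norm (gauss_coeff c k * (1/4) ^ k) \<le> gauss_coeff c k" if "k \<ge> 0" for k
      using gauss_coeff_nonneg[OF c, of k] mult_left_mono[of "(1/4::real) ^ k" 1 "gauss_coeff c k"]
      by (simp add: abs_mult power_le_one)
  qed
  then have "(\<lambda>k. gauss_coeff c k * (1/4) ^ k) sums hyp2F1 (-1/2) (-1/2) c (1/4)"
    by (simp add: hyp2F1_def eval_fps_def gauss_coeff_def power2_eq_square sums_iff)
  from sums_diff[OF gauss_sum_minus_half[OF c] sums_mult[OF this, of 2]]
  have "(\<lambda>k. (1 - 2 / 4 ^ k) * gauss_coeff c k) sums
      (Gamma c * Gamma (c + 1) / (Gamma (c + 1/2))\<^sup>2 - 2 * hyp2F1 (-1/2) (-1/2) c (1/4))"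
    by (simp add: algebra_simps power_divide)
  then have "(\<lambda>k. (1 - 2 / 4 ^ Suc k) * gauss_coeff c (Suc k)) sums
      (Gamma c * Gamma (c + 1) / (Gamma (c + 1/2))\<^sup>2 - 2 * hyp2F1 (-1/2) (-1/2) c (1/4) + 1)"
    by (subst sums_Suc_iff) simp
  then show ?thesis
    by (simp add: A_const_def c_def add_divide_distrib)
qed
lemma A_const_term_nonneg:
  assumes "p > 0"
  shows "0 \<le> (1 - 2 / 4 ^ Suc k) * gauss_coeff (real p / 2) (Suc k)"
proof -
  have "(2::real) / 4 ^ Suc k \<le> 1"
    using power_increasing[of 1 "Suc k" "4::real"] by (simp del: power_Suc)
  then show ?thesis
    using gauss_coeff_nonneg[of "real p / 2" "Suc k"] assms by (intro mult_nonneg_nonneg) auto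
qed

lemma A_const_nonneg: "p > 0 \<Longrightarrow> A_const p \<ge> 0"
  by (rule sums_le[OF A_const_term_nonneg sums_zero A_const_sums])

section \<open>The distance covariance of a standard normal vector with itself\<close>

text \<open>
  The left-hand terms are those of \<open>cosh (2 x) - 2 cosh x + 1\<close>; its constant term is zero, which is
  why the series starts at \<open>x\<^sup>2\<close> and the singular weights below stay integrable.
\<close>

lemma even_part_expansion:
  fixes x :: real
  shows "(\<lambda>k. (4 ^ Suc k - 2) / fact (2 * Suc k) * x ^ (2 * Suc k)) sums
    (((exp (- x) - 1)\<^sup>2 + (exp x - 1)\<^sup>2) / 2)"
proof -
  have "(\<lambda>k. (2 * x) ^ (2 * k) / fact (2 * k) - 2 * (x ^ (2 * k) / fact (2 * k))) sums
      (cosh (2 * x) - 2 * cosh x)"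
    by (intro sums_diff sums_mult cosh_sums)
  also have "(\<lambda>k. (2 * x) ^ (2 * k) / fact (2 * k) - 2 * (x ^ (2 * k) / fact (2 * k))) =
      (\<lambda>k. (4 ^ k - 2) / fact (2 * k) * x ^ (2 * k))"
    by (simp add: fun_eq_iff power_mult_distrib power_mult[of 2 2] diff_divide_distrib left_diff_distrib)
  finally have "(\<lambda>k. (4 ^ Suc k - 2) / fact (2 * Suc k) * x ^ (2 * Suc k)) sums
      (cosh (2 * x) - 2 * cosh x + 1)"
    by (subst sums_Suc_iff) simp
  also have "cosh (2 * x) - 2 * cosh x + 1 = ((exp (- x) - 1)\<^sup>2 + (exp x - 1)\<^sup>2) / 2"
    by (simp add: cosh_field_def power2_diff exp_double[symmetric] field_simps)
  finally show ?thesis .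
qed

text \<open>
  The integrand is the homogeneous function \<open>(s \<bullet> t)\<^sup>2\<^sup>k\<^sup>+\<^sup>2\<close> against a radial weight, so the
  singular weight changes the Gaussian moment by a quotient of Gamma values only.
\<close>

lemma weighted_moment:
  fixes t :: "'a::euclidean_space"
  shows "(\<integral>\<^sup>+s. ennreal ((s \<bullet> t) ^ (2 * Suc k) * (exp (- (norm s)\<^sup>2) / norm s ^ (DIM('a) + 1))) \<partial>lborel) =
    ennreal (Gamma (real k + 1/2) / Gamma (real DIM('a) / 2 + real (Suc k)) *
      (pi powr (real DIM('a) / 2) * fact (2 * Suc k) / (4 ^ Suc k * fact (Suc k))) * norm t ^ (2 * Suc k))"
proof -
  have par: "real (DIM('a) + 2 * Suc k + 0 - (DIM('a) + 1)) / 2 = real k + 1/2"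
    "real (DIM('a) + 2 * Suc k) / 2 = real DIM('a) / 2 + real (Suc k)"
    by (simp_all add: add_divide_distrib)
  have "(\<integral>\<^sup>+s. ennreal ((s \<bullet> t) ^ (2 * Suc k) *
        (exp (- (norm s)\<^sup>2) * norm s ^ 0 / norm s ^ (DIM('a) + 1))) \<partial>lborel) =
      ennreal (Gamma (real (DIM('a) + 2 * Suc k + 0 - (DIM('a) + 1)) / 2) / Gamma (real (DIM('a) + 2 * Suc k) / 2)) *
      (\<integral>\<^sup>+s. ennreal ((s \<bullet> t) ^ (2 * Suc k) * exp (- (norm s)\<^sup>2)) \<partial>lborel)"
  proof (rule homogeneous_gaussian_integral_norm_power)
    show "(s \<bullet> t) ^ (2 * Suc k) \<le> norm t ^ (2 * Suc k)" if "norm s \<le> 1" for s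
    proof -
      have "\<bar>s \<bullet> t\<bar> \<le> norm s * norm t" by (rule Cauchy_Schwarz_ineq2)
      also have "\<dots> \<le> norm t" using mult_right_mono[OF that, of "norm t"] by simp
      finally have "\<bar>s \<bullet> t\<bar> ^ (2 * Suc k) \<le> norm t ^ (2 * Suc k)" by (intro power_mono) auto
      then show ?thesis by (simp only: power_mult power2_abs)
    qed
    show "0 \<le> (s \<bullet> t) ^ (2 * Suc k)" for s by (simp only: power_mult) simp
    show "((c *\<^sub>R s) \<bullet> t) ^ (2 * Suc k) = c ^ (2 * Suc k) * (s \<bullet> t) ^ (2 * Suc k)" for c s
      by (simp only: inner_scaleR_left power_mult_distrib)
  qed auto
  then show ?thesis
    unfolding par nn_integral_gaussian_moment
    by (subst (asm) ennreal_mult'[symmetric]) (auto simp: mult_ac intro!: mult_nonneg_nonneg divide_nonneg_nonneg Gamma_real_nonneg)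
qed

text \<open>
  The constant function \<open>1\<close> is homogeneous of degree \<open>0\<close>; the power of the norm belongs to the radial
  weight.
\<close>

lemma weighted_norm_moment:
  "(\<integral>\<^sup>+t. ennreal (exp (- (norm t)\<^sup>2) / norm t ^ (DIM('a) + 1) * norm t ^ (2 * Suc k)) \<partial>(lborel :: 'a::euclidean_space measure)) =
    ennreal (c_const (DIM('a) - 1) * Gamma (real k + 1/2))"
proof -
  have par: "real (DIM('a) + 0 + 2 * Suc k - (DIM('a) + 1)) / 2 = real k + 1/2"
    by (simp add: add_divide_distrib)
  have "DIM('a) > 0" by simp
  then have c: "c_const (DIM('a) - 1) = pi powr (real DIM('a) / 2) / Gamma (real DIM('a) / 2)"
    by (simp add: c_const_def of_nat_diff Suc_leI)
  have "(\<integral>\<^sup>+t. ennreal (1 * (exp (- (norm t)\<^sup>2) * norm t ^ (2 * Suc k) / norm t ^ (DIM('a) + 1))) \<partial>(lborel :: 'a measure)) =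
      ennreal (Gamma (real (DIM('a) + 0 + 2 * Suc k - (DIM('a) + 1)) / 2) / Gamma (real (DIM('a) + 0) / 2)) *
      (\<integral>\<^sup>+t. ennreal (1 * exp (- (norm t)\<^sup>2)) \<partial>(lborel :: 'a measure))"
    by (rule homogeneous_gaussian_integral_norm_power[where B = 1]) auto
  also have "(\<integral>\<^sup>+t. ennreal (1 * exp (- (norm t)\<^sup>2)) \<partial>(lborel :: 'a measure)) =
      ennreal (pi powr (real DIM('a) / 2))"
    using nn_integral_gaussian_exponential[of "0::'a"] by simp
  finally show ?thesis
    unfolding par c
    by (subst (asm) ennreal_mult'[symmetric]) (auto simp: mult_ac intro!: Gamma_real_nonneg)
qed

text \<open>
  Coefficient bookkeeping: both factors \<open>\<Gamma>(k + 1/2)\<close> are multiples of the Pochhammer symbol of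
  \<open>-1/2\<close>, and the factorials of \<open>2 k + 2\<close> cancel.
\<close>

lemma distance_covariance_series_term:
  assumes "p > 0"
  shows "(4 ^ Suc k - 2) / fact (2 * Suc k) *
      (Gamma (real k + 1/2) / Gamma (real p / 2 + real (Suc k)) *
        (pi powr (real p / 2) * fact (2 * Suc k) / (4 ^ Suc k * fact (Suc k)))) *
      (c_const (p - 1) * Gamma (real k + 1/2)) =
    4 * pi * (c_const (p - 1))\<^sup>2 * ((1 - 2 / 4 ^ Suc k) * gauss_coeff (real p / 2) (Suc k))"
proof -
  have ni: "z \<notin> \<int>\<^sub>\<le>\<^sub>0" if "z > 0" for z :: real using that by (auto elim!: nonpos_Ints_cases)
  define c where "c = real p / 2"
  have c: "c > 0" using assms by (simp add: c_def)
  have "pochhammer (1/2::real) k = Gamma (1/2 + real k) / Gamma (1/2)"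
    by (rule pochhammer_Gamma) (simp add: ni)
  moreover have "pochhammer (-1/2::real) (Suc k) = -1/2 * pochhammer (1/2) k"
    by (simp add: pochhammer_rec)
  ultimately have "Gamma (real k + 1/2) = -2 * sqrt pi * pochhammer (-1/2) (Suc k)"
    by (simp add: Gamma_one_half_real add.commute)
  then have G1: "(Gamma (real k + 1/2))\<^sup>2 = 4 * pi * (pochhammer (-1/2) (Suc k))\<^sup>2"
    by (simp only: power_mult_distrib) simp
  have "pochhammer c (Suc k) = Gamma (c + real (Suc k)) / Gamma c"
    by (rule pochhammer_Gamma) (simp add: ni c)
  moreover have G0: "Gamma c > 0" using c by (rule Gamma_real_pos)
  ultimately have G2: "Gamma (c + real (Suc k)) = Gamma c * pochhammer c (Suc k)"
    by (simp add: field_simps)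
  have pc: "pochhammer c (Suc k) > 0" using c by (rule pochhammer_pos)
  have cc: "pi powr c = c_const (p - 1) * Gamma c"
  proof -
    have "(real (p - 1) + 1) / 2 = c" using assms by (simp add: c_def of_nat_diff Suc_leI)
    then show ?thesis using less_imp_neq[OF G0] by (simp only: c_const_def) simp
  qed
  have "(4 ^ Suc k - 2) / fact (2 * Suc k) *
      (Gamma (real k + 1/2) / Gamma (c + real (Suc k)) *
        (pi powr c * fact (2 * Suc k) / (4 ^ Suc k * fact (Suc k)))) *
      (c_const (p - 1) * Gamma (real k + 1/2)) =
      (4 ^ Suc k - 2) / 4 ^ Suc k * (Gamma (real k + 1/2))\<^sup>2 * (pi powr c / Gamma (c + real (Suc k)))
        * c_const (p - 1) / fact (Suc k)"
    by (simp add: power2_eq_square mult_ac del: fact_Suc power_Suc of_nat_Suc)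
  also have "pi powr c / Gamma (c + real (Suc k)) = c_const (p - 1) / pochhammer c (Suc k)"
    unfolding G2 cc using G0 by simp
  also have "(4 ^ Suc k - 2) / 4 ^ Suc k = (1 - 2 / 4 ^ Suc k :: real)"
    by (simp add: diff_divide_distrib)
  also have "(1 - 2 / 4 ^ Suc k) * (Gamma (real k + 1/2))\<^sup>2 * (c_const (p - 1) / pochhammer c (Suc k))
        * c_const (p - 1) / fact (Suc k) =
      4 * pi * (c_const (p - 1))\<^sup>2 * ((1 - 2 / 4 ^ Suc k) * gauss_coeff c (Suc k))"
    unfolding G1 gauss_coeff_def
    by (simp add: power2_eq_square del: fact_Suc power_Suc of_nat_Suc)
  finally show ?thesis unfolding c_def .
qed

text \<open>
  Averaging the inner integral over \<open>t\<close> and \<open>-t\<close> leaves the even part of the integrand. All its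
  Taylor coefficients are nonnegative, so sums and integrals commute freely.
\<close>

lemma gaussian_distance_covariance_integral:
  defines "w \<equiv> \<lambda>s::'a::euclidean_space. exp (- (norm s)\<^sup>2) / norm s ^ (DIM('a) + 1)"
  shows "(\<integral>\<^sup>+s. \<integral>\<^sup>+t. ennreal (w s * w t * (exp (- (s \<bullet> t)) - 1)\<^sup>2) \<partial>lborel \<partial>lborel) =
    ennreal (4 * pi * (c_const (DIM('a) - 1))\<^sup>2 * A_const DIM('a))"
proof -
  have w[measurable]: "w \<in> borel_measurable borel" by (simp add: w_def)
  have w0: "w s \<ge> 0" for s by (simp add: w_def)
  define q where "q k = (4 ^ Suc k - 2) / (fact (2 * Suc k) :: real)" for k
  have q0: "q k \<ge> 0" for k
    using power_increasing[of 1 "Suc k" "4::real"] by (simp add: q_def del: power_Suc)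
  define K where "K k = Gamma (real k + 1/2) / Gamma (real DIM('a) / 2 + real (Suc k)) *
      (pi powr (real DIM('a) / 2) * fact (2 * Suc k) / (4 ^ Suc k * fact (Suc k)))" for k
  have K0: "K k \<ge> 0" for k
    by (auto simp: K_def intro!: mult_nonneg_nonneg divide_nonneg_nonneg Gamma_real_nonneg)
  have e0: "x ^ (2 * n) \<ge> 0" for x :: real and n by (simp add: power_mult)
  have inner: "(\<integral>\<^sup>+t. ennreal (w s * w t * (exp (- (s \<bullet> t)) - 1)\<^sup>2) \<partial>lborel) =
      (\<Sum>k. ennreal (q k * K k) * ennreal (w s * norm s ^ (2 * Suc k)))" for s
  proof -
    have half: "ennreal (1/2) + ennreal (1/2) = 1"
      by (subst ennreal_plus[symmetric]) auto
    let ?h = "\<lambda>t. ennreal (w s * w t * (exp (- (s \<bullet> t)) - 1)\<^sup>2)"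
    \<comment> \<open>Reflection symmetry of Lebesgue measure.\<close>
    have "(\<integral>\<^sup>+t. ?h t \<partial>lborel) = (\<integral>\<^sup>+t. ?h (- t) \<partial>lborel)"
      by (subst nn_integral_lborel_scaleR[of _ "-1"]) auto
    then have "(\<integral>\<^sup>+t. ?h t \<partial>lborel) =
        ennreal (1/2) * (\<integral>\<^sup>+t. ?h t \<partial>lborel) + ennreal (1/2) * (\<integral>\<^sup>+t. ?h (- t) \<partial>lborel)"
      by (simp only: distrib_right[symmetric] half mult_1)
    also have "\<dots> = (\<integral>\<^sup>+t. ennreal (1/2) * ?h t + ennreal (1/2) * ?h (- t) \<partial>lborel)"
      by (subst nn_integral_add) (auto simp: nn_integral_cmult)
    also have "\<dots> = (\<integral>\<^sup>+t. (\<Sum>k. ennreal (q k * w s) * ennreal ((t \<bullet> s) ^ (2 * Suc k) * w t)) \<partial>lborel)"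
    proof (rule nn_integral_cong)
      fix t :: 'a
      have wm: "w (- t) = w t" by (simp add: w_def)
      have "(\<lambda>k. w s * w t * (q k * (s \<bullet> t) ^ (2 * Suc k))) sums
          (w s * w t * (((exp (- (s \<bullet> t)) - 1)\<^sup>2 + (exp (s \<bullet> t) - 1)\<^sup>2) / 2))"
        unfolding q_def by (intro sums_mult even_part_expansion)
      then have sm: "(\<lambda>k. q k * w s * ((t \<bullet> s) ^ (2 * Suc k) * w t)) sums
          (w s * w t * (((exp (- (s \<bullet> t)) - 1)\<^sup>2 + (exp (s \<bullet> t) - 1)\<^sup>2) / 2))"
        by (simp only: mult_ac inner_commute)
      have "ennreal (1/2) * ?h t + ennreal (1/2) * ?h (- t) =
          ennreal (w s * w t * (((exp (- (s \<bullet> t)) - 1)\<^sup>2 + (exp (s \<bullet> t) - 1)\<^sup>2) / 2))"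
        using w0 by (subst ennreal_average) (auto simp: wm algebra_simps intro!: mult_nonneg_nonneg)
      also have "\<dots> = (\<Sum>k. ennreal (q k * w s * ((t \<bullet> s) ^ (2 * Suc k) * w t)))"
        by (intro suminf_ennreal_eq[symmetric] mult_nonneg_nonneg q0 w0 e0 sm)
      also have "\<dots> = (\<Sum>k. ennreal (q k * w s) * ennreal ((t \<bullet> s) ^ (2 * Suc k) * w t))"
        using q0 w0 e0 by (intro suminf_cong ennreal_mult mult_nonneg_nonneg)
      finally show "ennreal (1/2) * ?h t + ennreal (1/2) * ?h (- t) =
          (\<Sum>k. ennreal (q k * w s) * ennreal ((t \<bullet> s) ^ (2 * Suc k) * w t))" .
    qed
    also have "\<dots> = (\<Sum>k. \<integral>\<^sup>+t. ennreal (q k * w s) * ennreal ((t \<bullet> s) ^ (2 * Suc k) * w t) \<partial>lborel)"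
      by (rule nn_integral_suminf) measurable
    also have "\<dots> = (\<Sum>k. ennreal (q k * w s) * (\<integral>\<^sup>+t. ennreal ((t \<bullet> s) ^ (2 * Suc k) * w t) \<partial>lborel))"
      by (intro suminf_cong nn_integral_cmult) measurable
    also have "\<dots> = (\<Sum>k. ennreal (q k * w s) * ennreal (K k * norm s ^ (2 * Suc k)))"
      unfolding w_def weighted_moment K_def ..
    also have "\<dots> = (\<Sum>k. ennreal (q k * K k) * ennreal (w s * norm s ^ (2 * Suc k)))"
      using q0 w0 K0 e0 by (intro suminf_cong) (simp add: ennreal_mult[symmetric] mult_ac del: power_Suc)
    finally show ?thesis .
  qed
  have "(\<integral>\<^sup>+s. \<integral>\<^sup>+t. ennreal (w s * w t * (exp (- (s \<bullet> t)) - 1)\<^sup>2) \<partial>lborel \<partial>lborel) =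
      (\<Sum>k. \<integral>\<^sup>+s. ennreal (q k * K k) * ennreal (w s * norm s ^ (2 * Suc k)) \<partial>lborel)"
    unfolding inner by (rule nn_integral_suminf) measurable
  also have "\<dots> = (\<Sum>k. ennreal (q k * K k) * (\<integral>\<^sup>+s. ennreal (w s * norm s ^ (2 * Suc k)) \<partial>lborel))"
    by (intro suminf_cong nn_integral_cmult) measurable
  also have "\<dots> = (\<Sum>k. ennreal (q k * K k) * ennreal (c_const (DIM('a) - 1) * Gamma (real k + 1/2)))"
    unfolding w_def weighted_norm_moment ..
  also have "\<dots> = (\<Sum>k. ennreal (4 * pi * (c_const (DIM('a) - 1))\<^sup>2 *
      ((1 - 2 / 4 ^ Suc k) * gauss_coeff (real DIM('a) / 2) (Suc k))))"
    using q0 K0 unfolding distance_covariance_series_term[OF DIM_positive, symmetric] q_def[symmetric] K_def[symmetric]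
    by (intro suminf_cong ennreal_mult'[symmetric] mult_nonneg_nonneg)
  also have "\<dots> = ennreal (4 * pi * (c_const (DIM('a) - 1))\<^sup>2 * A_const DIM('a))"
  proof (rule suminf_ennreal_eq)
    show "0 \<le> 4 * pi * (c_const (DIM('a) - 1))\<^sup>2 *
        ((1 - 2 / 4 ^ Suc k) * gauss_coeff (real DIM('a) / 2) (Suc k))" for k
      by (rule mult_nonneg_nonneg) (simp, rule A_const_term_nonneg[OF DIM_positive])
    show "(\<lambda>k. 4 * pi * (c_const (DIM('a) - 1))\<^sup>2 *
        ((1 - 2 / 4 ^ Suc k) * gauss_coeff (real DIM('a) / 2) (Suc k))) sums
        (4 * pi * (c_const (DIM('a) - 1))\<^sup>2 * A_const DIM('a))"
      by (intro sums_mult A_const_sums DIM_positive)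
  qed
  finally show ?thesis .
qed

text \<open>
  The mean only contributes the unimodular factor \<open>exp (i (s + t) \<bullet> m)\<close>, common to both
  terms of the difference, which the modulus removes.
\<close>

lemma dist_cov_standard_normal:
  fixes W :: "'a \<Rightarrow> real ^ 'n"
  assumes "multivariate_normal M W m (mat 1)"
  shows "(dist_cov M W W)\<^sup>2 =
    4 * pi * (c_const (CARD('n) - 1))\<^sup>2 / (c_const CARD('n))\<^sup>2 * A_const CARD('n)"
proof -
  let ?w = "\<lambda>s::real^'n. exp (- (norm s)\<^sup>2) / norm s ^ (DIM(real^'n) + 1)"
  let ?g = "\<lambda>s t. (cmod (joint_char M W W s t - joint_char M W W s 0 * joint_char M W W 0 t))\<^sup>2 /
        (norm s ^ (DIM(real^'n) + 1) * norm t ^ (DIM(real^'n) + 1))"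
  have ch: "joint_char M W W s t = iexp ((s + t) \<bullet> m) * complex_of_real (exp (- ((norm (s + t))\<^sup>2) / 2))" for s t
    using multivariate_normal_char[OF assms, of "s + t"]
    by (simp add: joint_char_def inner_add_left dot_square_norm exp_of_real[symmetric])
  have g: "?g s t = ?w s * ?w t * (exp (- (s \<bullet> t)) - 1)\<^sup>2" for s t
  proof -
    have nrm: "(norm (s + t))\<^sup>2 = (norm s)\<^sup>2 + (norm t)\<^sup>2 + 2 * (s \<bullet> t)"
      by (simp add: power2_norm_eq_inner inner_add_left inner_add_right inner_commute)
    have "joint_char M W W s t - joint_char M W W s 0 * joint_char M W W 0 t =
        iexp ((s + t) \<bullet> m) * complex_of_real (exp (- (norm s)\<^sup>2 / 2) * exp (- (norm t)\<^sup>2 / 2) * (exp (- (s \<bullet> t)) - 1))"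
    proof -
      have i: "iexp ((s + t) \<bullet> m) = iexp (s \<bullet> m) * iexp (t \<bullet> m)"
        by (simp add: inner_add_left distrib_left exp_add)
      have "- ((norm s)\<^sup>2 + (norm t)\<^sup>2 + 2 * (s \<bullet> t)) / 2 = - (norm s)\<^sup>2 / 2 + - (norm t)\<^sup>2 / 2 + - (s \<bullet> t)"
        by simp
      then have e: "exp (- (norm (s + t))\<^sup>2 / 2) =
          exp (- (norm s)\<^sup>2 / 2) * exp (- (norm t)\<^sup>2 / 2) * exp (- (s \<bullet> t))"
        unfolding nrm by (simp only: exp_add)
      show ?thesis
        unfolding ch e add_0_left add_0_right i by (simp add: algebra_simps)
    qed
    then have "(cmod (joint_char M W W s t - joint_char M W W s 0 * joint_char M W W 0 t))\<^sup>2 =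
        (exp (- (norm s)\<^sup>2 / 2) * exp (- (norm t)\<^sup>2 / 2) * (exp (- (s \<bullet> t)) - 1))\<^sup>2"
      by (simp only: norm_mult norm_exp_i_times norm_of_real mult_1_left power2_abs)
    also have "\<dots> = exp (- (norm s)\<^sup>2) * exp (- (norm t)\<^sup>2) * (exp (- (s \<bullet> t)) - 1)\<^sup>2"
      by (simp add: power_mult_distrib exp_double[symmetric])
    finally show ?thesis by simp
  qed
  let ?h = "\<lambda>z. case z of (s, t) \<Rightarrow> ?w s * ?w t * (exp (- (s \<bullet> t)) - 1)\<^sup>2"
  have meas: "?h \<in> borel_measurable lborel"
    unfolding lborel_prod[symmetric] by measurable
  have "(\<integral>\<^sup>+z. ennreal (case z of (s, t) \<Rightarrow> ?g s t) \<partial>lborel) =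
      (\<integral>\<^sup>+s. \<integral>\<^sup>+t. ennreal (?w s * ?w t * (exp (- (s \<bullet> t)) - 1)\<^sup>2) \<partial>lborel \<partial>lborel)"
  proof -
    have "(\<integral>\<^sup>+z. ennreal (?h z) \<partial>(lborel \<Otimes>\<^sub>M lborel)) = (\<integral>\<^sup>+s. \<integral>\<^sup>+t. ennreal (?h (s, t)) \<partial>lborel \<partial>lborel)"
      using meas by (intro lborel.nn_integral_fst[symmetric]) (simp add: lborel_prod)
    then show ?thesis by (simp only: g lborel_prod prod.case)
  qed
  also have "\<dots> = ennreal (4 * pi * (c_const (CARD('n) - 1))\<^sup>2 * A_const CARD('n))"
    using gaussian_distance_covariance_integral[where 'a = "real^'n"] by simp
  finally have nn: "(\<integral>\<^sup>+z. ennreal (case z of (s, t) \<Rightarrow> ?g s t) \<partial>lborel) =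
      ennreal (4 * pi * (c_const (CARD('n) - 1))\<^sup>2 * A_const CARD('n))" .
  have "A_const CARD('n) \<ge> 0"
    by (simp add: A_const_nonneg)
  then have int: "(\<integral>z. (case z of (s, t) \<Rightarrow> ?g s t) \<partial>lborel) =
      4 * pi * (c_const (CARD('n) - 1))\<^sup>2 * A_const CARD('n)"
  proof -
    have "(\<integral>z. (case z of (s, t) \<Rightarrow> ?g s t) \<partial>lborel) =
        enn2real (\<integral>\<^sup>+z. ennreal (case z of (s, t) \<Rightarrow> ?g s t) \<partial>lborel)"
    proof (rule integral_eq_nn_integral)
      show "(\<lambda>z. case z of (s, t) \<Rightarrow> ?g s t) \<in> borel_measurable lborel"
        unfolding g by (rule meas)
      show "AE z in lborel. 0 \<le> (case z of (s, t) \<Rightarrow> ?g s t)"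
        by (rule AE_I2) (simp only: g split: prod.split, simp)
    qed
    then show ?thesis using \<open>A_const CARD('n) \<ge> 0\<close> unfolding nn by simp
  qed
  have "c_const CARD('n) * c_const CARD('n) \<ge> 0" by simp
  with \<open>A_const CARD('n) \<ge> 0\<close> show ?thesis
    unfolding dist_cov_def int by (simp add: power2_eq_square)
qed

lemma multivariate_normal_whiten:
  fixes X :: "'a \<Rightarrow> real ^ 'n"
  assumes "multivariate_normal M X m S" "invertible S"
  shows "multivariate_normal M (\<lambda>\<omega>. matrix_inv_sqrt S *v X \<omega>) (matrix_inv_sqrt S *v m) (mat 1)"
proof -
  let ?R = "matrix_inv_sqrt S"
  have X[measurable]: "X \<in> borel_measurable M" and psd: "psd_matrix S"
    and D: "\<And>u. distr M borel (\<lambda>\<omega>. u \<bullet> X \<omega>) = normal_law (u \<bullet> m) (u \<bullet> (S *v u))"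
    using assms by (auto simp: multivariate_normal_def)
  note R = matrix_inv_sqrt_whitens[OF psd assms(2)]
  have "(*v) ?R \<in> borel_measurable borel"
    by (intro borel_measurable_continuous_onI linear_continuous_on) (simp add: linear_conv_bounded_linear[symmetric])
  then have "(\<lambda>\<omega>. ?R *v X \<omega>) \<in> borel_measurable M"
    using X by measurable
  moreover have "psd_matrix (mat 1 :: real ^ 'n ^ 'n)"
    by (simp add: psd_matrix_def transpose_mat)
  moreover have "distr M borel (\<lambda>\<omega>. u \<bullet> (?R *v X \<omega>)) = normal_law (u \<bullet> (?R *v m)) (u \<bullet> (mat 1 *v u))" for u
    using D[of "?R *v u"] by (simp add: R)
  ultimately show ?thesis by (simp add: multivariate_normal_def)
qed

theorem corollary3p3:
  fixes M :: "'a measure"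
    and X :: "'a \<Rightarrow> real ^ 'p"
    and Y :: "'a \<Rightarrow> real ^ 'q"
    and \<mu> :: "real ^ ('p + 'q)"
    and \<Sigma>X :: "real ^ 'p ^ 'p"
    and \<Sigma>XY :: "real ^ 'q ^ 'p"
    and \<Sigma>Y :: "real ^ 'q ^ 'q"
  assumes "prob_space M"
    and "multivariate_normal M (\<lambda>\<omega>. stack (X \<omega>) (Y \<omega>)) \<mu>
           (block_matrix \<Sigma>X \<Sigma>XY (transpose \<Sigma>XY) \<Sigma>Y)"
    and "invertible \<Sigma>X"
    and "invertible \<Sigma>Y"
  shows "(aff_dist_cov M X X)\<^sup>2 =
           4 * pi * (c_const (CARD('p) - 1))\<^sup>2 / (c_const CARD('p))\<^sup>2 * A_const CARD('p)"
proof -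
  have X: "multivariate_normal M X (\<chi> a. \<mu> $ Inl a) \<Sigma>X"
    using assms(2) by (rule multivariate_normal_first_block)
  have "cov_matrix M X = \<Sigma>X"
    using assms(1) X by (rule cov_matrix_multivariate_normal)
  then show ?thesis
    unfolding aff_dist_cov_def
    using dist_cov_standard_normal[OF multivariate_normal_whiten[OF X assms(3)]] by simp
qed

end
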